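(* Assume the Slater condition (there is a positive definite $X^0\in\mathbb{S}^n$ with $\mathcal{R}_\alpha(X^0)=\mathcal{R}_\alpha(\overline X)$). If $\rho_m\to0$, $\sqrt m\,\rho_m\to\infty$ and $\gamma_m=O_p(1)$, then a sufficient condition for the rank consistency of $\widehat X_m$ (i.e., $\lim_{m\to\infty}\Pr(\mathrm{rank}(\widehat X_m)=\mathrm{rank}(\overline X))=1$) is that the linear system $$\overline P_2^{\mathbb{T}}\mathcal{Q}_\beta^\dagger(\overline P_2\Lambda\overline P_2^{\mathbb{T}})\overline P_2=\overline P_2^{\mathbb{T}}\mathcal{Q}_\beta^\dagger\big(I_n-F(\overline X)\big)\overline P_2,\quad\Lambda\in\mathbb{S}^{n-r},$$ has a unique solution $\widehat\Lambda$ and $\widehat\Lambda$ is positive definite.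
   Context: Positive semidefinite setting: $\mathbb{S}^n$ denotes either the real symmetric or the Hermitian $n\times n$ matrices, a real inner product space with $\langle X,Y\rangle=\mathrm{Re}\,\mathrm{Tr}(X^{\mathbb{T}}Y)$ ($^{\mathbb{T}}$ = transpose or conjugate transpose); $\|\cdot\|_F$ is the Frobenius norm. $\{\Theta_1,\dots,\Theta_d\}$ is an orthonormal basis of $\mathbb{S}^n$, $\alpha\subseteq\{1,\dots,d\}$, $\beta$ its complement, $\mathcal{R}_\pi(X)=(\langle\Theta_k,X\rangle)_{k\in\pi}$. Let $p_k>0$ ($k\in\beta$), $\sum_{k\in\beta}p_k=1$, $\mathcal{Q}_\beta^\dagger(X)=\sum_{k\in\beta}p_k^{-1}\langle\Theta_k,X\rangle\Theta_k$. The unknown $\overline X$ is positive semidefinite of rank $r\ge1$, with eigendecomposition $\overline X=\overline P\mathrm{Diag}(\lambda(\overline X))\overline P^{\mathbb{T}}$, eigenvalues nonincreasing, $\overline P=[\overline P_1\ \overline P_2]$ orthogonal/unitary, $\overline P_1$ having $r$ columns. Observations: $\omega_1,\dots,\omega_m$ i.i.d. with $\Pr(\omega_i=k)=p_k$ for $k\in\beta$, $0$ for $k\in\alpha$; $\xi_i$ i.i.d., independent of the $\omega_i$, $\mathbb{E}\xi_i=0$, $\mathbb{E}\xi_i^2=1$; $\nu>0$; $y_i=\langle\Theta_{\omega_i},\overline X\rangle+\nu\xi_i$; $\mathcal{R}_\Omega(X)=(\langle\Theta_{\omega_i},X\rangle)_{i=1}^m$. $F$ is the spectral operator of a symmetric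 function $f:\mathbb{R}^n\to\mathbb{R}^n$ ($f(x)=Q^{\mathbb{T}}f(Qx)$ for all signed permutation matrices $Q$); for positive semidefinite $X=P\mathrm{Diag}(\lambda(X))P^{\mathbb{T}}$, $F(X)=P\mathrm{Diag}(f(\lambda(X)))P^{\mathbb{T}}$. Given a positive semidefinite initial estimator $\widetilde X_m$, $\rho_m>0$, $\gamma_m\ge0$, $\widehat X_m$ is an optimal solution of $$\min_{X\in\mathbb{S}^n}\ \frac1{2m}\|y-\mathcal{R}_\Omega(X)\|_2^2+\rho_m\Big(\langle I_n-F(\widetilde X_m),X\rangle+\frac{\gamma_m}2\|X-\widetilde X_m\|_F^2\Big)\ \text{s.t. }\mathcal{R}_\alpha(X)=\mathcal{R}_\alpha(\overline X),\ X\text{ positive semidefinite}.$$ Standing assumptions: $n$ fixed, $m\to\infty$; $F$ continuous at $\overline X$; $\widetilde X_m\xrightarrow{p}\overline X$. *)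

theory Defs
  imports "HOL-Probability.Probability"
begin

text \<open>Matrices are elements of complex^'n^'n.  The flag rc selects the real case
  (real symmetric matrices, orthogonal matrices; all entries real) versus the
  complex case (Hermitian matrices, unitary matrices).\<close>

definition Kset :: "bool \<Rightarrow> complex set" where
  "Kset rc = (if rc then range complex_of_real else UNIV)"

definition adjm :: "complex^'n^'m \<Rightarrow> complex^'m^'n" where
  "adjm A = (\<chi> i j. cnj (A $ j $ i))"

definition entries_in_K :: "bool \<Rightarrow> complex^'n^'m \<Rightarrow> bool" where
  "entries_in_K rc A \<longleftrightarrow> (\<forall>i j. A $ i $ j \<in> Kset rc)"

definition SymK :: "bool \<Rightarrow> (complex^'n^'n) set" where
  "SymK rc = {A. adjm A = A \<and> entries_in_K rc A}"

definition ipS :: "complex^'n^'n \<Rightarrow> complex^'n^'n \<Rightarrow> real" where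
  "ipS X Y = Re (trace (adjm X ** Y))"

definition unitaryK :: "bool \<Rightarrow> complex^'n^'n \<Rightarrow> bool" where
  "unitaryK rc P \<longleftrightarrow> entries_in_K rc P \<and> adjm P ** P = mat 1"

definition diagm :: "real^'n \<Rightarrow> complex^'n^'n" where
  "diagm l = (\<chi> i j. if i = j then complex_of_real (l $ i) else 0)"

definition qform :: "complex^'n \<Rightarrow> complex^'n^'n \<Rightarrow> complex" where
  "qform v X = (\<Sum>i\<in>UNIV. cnj (v $ i) * (X *v v) $ i)"

definition vec_in_K :: "bool \<Rightarrow> complex^'n \<Rightarrow> bool" where
  "vec_in_K rc v \<longleftrightarrow> (\<forall>i. v $ i \<in> Kset rc)"

definition psdK :: "bool \<Rightarrow> complex^'n^'n \<Rightarrow> bool" where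
  "psdK rc X \<longleftrightarrow> X \<in> SymK rc \<and> (\<forall>v. vec_in_K rc v \<longrightarrow> 0 \<le> Re (qform v X))"

definition pdK :: "bool \<Rightarrow> complex^'n^'n \<Rightarrow> bool" where
  "pdK rc X \<longleftrightarrow> X \<in> SymK rc \<and> (\<forall>v. vec_in_K rc v \<and> v \<noteq> 0 \<longrightarrow> 0 < Re (qform v X))"

definition nonincr :: "real^'n::{finite,linorder} \<Rightarrow> bool" where
  "nonincr l \<longleftrightarrow> (\<forall>i j. i \<le> j \<longrightarrow> l $ j \<le> l $ i)"

definition symmetric_fun :: "(real^'n \<Rightarrow> real^'n) \<Rightarrow> bool" where
  "symmetric_fun f \<longleftrightarrow> (\<forall>\<sigma> s x. \<sigma> permutes (UNIV::'n set) \<and> (\<forall>i. s i = 1 \<or> s i = -1) \<longrightarrow>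
      f (\<chi> i. s i * x $ (\<sigma> i)) = (\<chi> i. s i * f x $ (\<sigma> i)))"

definition spectral_op :: "bool \<Rightarrow> ((real, 'n::{finite,linorder}) vec \<Rightarrow> (real, 'n) vec)
    \<Rightarrow> (((complex, 'n) vec, 'n) vec \<Rightarrow> ((complex, 'n) vec, 'n) vec) \<Rightarrow> bool" where
  "spectral_op rc f F \<longleftrightarrow> symmetric_fun f \<and>
     (\<forall>X P l. X \<in> SymK rc \<and> unitaryK rc P \<and> nonincr l \<and> X = P ** diagm l ** adjm P
        \<longrightarrow> F X = P ** diagm (f l) ** adjm P)"

definition Qdag :: "(nat \<Rightarrow> complex^'n^'n) \<Rightarrow> nat set \<Rightarrow> (nat \<Rightarrow> real)
    \<Rightarrow> complex^'n^'n \<Rightarrow> complex^'n^'n" where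
  "Qdag \<Theta> \<beta> p X = (\<Sum>k\<in>\<beta>. (ipS (\<Theta> k) X / p k) *\<^sub>R \<Theta> k)"

text \<open>Index i is among the last n - r indices (the columns of P2).\<close>
definition in_block :: "nat \<Rightarrow> 'n::{finite,linorder} \<Rightarrow> bool" where
  "in_block r i \<longleftrightarrow> r \<le> card {j. j < i}"

text \<open>S^{n-r} embedded as the matrices of S^n supported on the trailing (n-r)x(n-r) block;
  for such \<Lambda>, P2 \<Lambda>2 P2^T = P \<Lambda> P^T and P2^T M P2 is the trailing block of P^T M P.\<close>
definition block_sym :: "bool \<Rightarrow> nat \<Rightarrow> ((complex, 'n::{finite,linorder}) vec, 'n) vec \<Rightarrow> bool" where
  "block_sym rc r L \<longleftrightarrow> L \<in> SymK rc \<and> (\<forall>i j. \<not> (in_block r i \<and> in_block r j) \<longrightarrow> L $ i $ j = 0)"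

definition lin_system :: "(nat \<Rightarrow> ((complex, 'n::{finite,linorder}) vec, 'n) vec) \<Rightarrow> nat set \<Rightarrow> (nat \<Rightarrow> real)
    \<Rightarrow> ((complex, 'n) vec, 'n) vec \<Rightarrow> ((complex, 'n) vec, 'n) vec \<Rightarrow> nat \<Rightarrow> ((complex, 'n) vec, 'n) vec \<Rightarrow> bool" where
  "lin_system \<Theta> \<beta> p P FX r L \<longleftrightarrow>
     (\<forall>i j. in_block r i \<and> in_block r j \<longrightarrow>
        (adjm P ** Qdag \<Theta> \<beta> p (P ** L ** adjm P) ** P) $ i $ j
          = (adjm P ** Qdag \<Theta> \<beta> p (mat 1 - FX) ** P) $ i $ j)"

definition block_pd :: "bool \<Rightarrow> nat \<Rightarrow> ((complex, 'n::{finite,linorder}) vec, 'n) vec \<Rightarrow> bool" where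
  "block_pd rc r L \<longleftrightarrow> (\<forall>v. vec_in_K rc v \<and> v \<noteq> 0 \<and> (\<forall>i. \<not> in_block r i \<longrightarrow> v $ i = 0)
       \<longrightarrow> 0 < Re (qform v L))"

definition objective :: "(nat \<Rightarrow> complex^'n^'n) \<Rightarrow> (nat \<Rightarrow> nat) \<Rightarrow> (nat \<Rightarrow> real) \<Rightarrow> nat
    \<Rightarrow> real \<Rightarrow> real \<Rightarrow> (complex^'n^'n \<Rightarrow> complex^'n^'n) \<Rightarrow> complex^'n^'n
    \<Rightarrow> complex^'n^'n \<Rightarrow> real" where
  "objective \<Theta> om y m rho gam F Xt X =
     1 / (2 * real m) * (\<Sum>i<m. (y i - ipS (\<Theta> (om i)) X)\<^sup>2)
     + rho * (ipS (mat 1 - F Xt) X + gam / 2 * (norm (X - Xt))\<^sup>2)"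

end

theory Submission
  imports Defs
begin

text \<open>Put \<open>S = P2 \<Lambda> P2\<^sup>T\<close>.  Positive definiteness of \<open>\<Lambda>\<close> makes \<open>S\<close> a strictly complementary
  multiplier of \<open>Xbar\<close>, and uniqueness of the solution of the linear system says that no nonzero
  combination \<open>a\<close> of the fixed directions satisfies \<open>a Xbar = 0\<close> (constraint nondegeneracy).

  With high probability the sampling frequencies are close to \<open>p\<close>, the noise is \<open>o(\<rho>)\<close> because
  \<open>sqrt m \<rho>\<close> diverges, and \<open>F\<close> at the initial estimator is close to \<open>F Xbar\<close>.  On this event the
  variational inequality of the estimator, tested at a feasible curve through \<open>Xbar\<close> with velocity
  \<open>Dhat = Qdag (S - (I - F Xbar))\<close>, shows that \<open>(Xh - Xbar) / \<rho>\<close> is close to \<open>Dhat\<close>.  Hence the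
  rescaled gradient at \<open>Xh\<close> is close to \<open>S\<close> modulo the fixed directions.  It annihilates the
  admissible tangent directions \<open>Xh W + W\<^sup>* Xh\<close>, so it splits as \<open>Z + a\<close> with \<open>Z Xh = 0\<close>; by
  nondegeneracy \<open>Z\<close> is close to \<open>S\<close>, which has corank \<open>r\<close>.  Thus \<open>rank Xh \<le> r\<close>, and lower
  semicontinuity of the rank gives equality.\<close>

section \<open>Rank of matrices\<close>

text \<open>The scale \<rho> comes from a balance: at \<open>Xbar + \<rho> *\<^sub>R D\<close> the
  loss changes by \<rho>^2 times a quadratic form in \<open>D\<close>, the penalty by \<rho>^2 times
  the linear form of \<open>mat 1 - F Xbar\<close>, and the noise by \<rho> times a mean of order 1
  / sqrt m, which is o(\<rho>^2). So the limiting problem is deterministic, and one \<epsilon> can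
  be fixed before any randomness appears; the probability part reduces to Chebyshev bounds and to
  products of a tight and a vanishing factor.

  The obstacle is that closeness to \<open>Xbar\<close> bounds the rank only from below. The upper
  bound has to come from a dual matrix, to which lower semicontinuity applies as well. The rescaled
  gradient is determined only in the \<beta> coordinates, since feasible differences have no
  \<alpha> coordinates; its \<alpha> coordinates are set to those of \<open>S\<close>. For the rank
  bound, stationarity along two-sided tangent directions suffices: it yields
  \<open>Z ** X = 0\<close> without eigenvalue perturbation or a general multiplier theorem. The
  Slater point bends tangent directions back into the cone without moving the fixed
  coordinates.\<close>

lemma rank_mult_le_right: "rank (A ** B :: 'a::field^'n^'m) \<le> rank (B :: 'a^'n^'k)"
proof -
  have "rows (A ** B) \<subseteq> vec.span (rows B)"
  proof
    fix v assume "v \<in> rows (A ** B)"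
    then obtain i where v: "v = row i (A ** B)" by (auto simp: rows_def)
    have "v = (\<Sum>k\<in>UNIV. (A $ i $ k) *s row k B)"
      by (simp add: v vec_eq_iff row_def matrix_matrix_mult_def)
    also have "\<dots> \<in> vec.span (rows B)"
      by (intro vec.span_sum vec.span_scale vec.span_base) (auto simp: rows_def)
    finally show "v \<in> vec.span (rows B)" .
  qed
  then show ?thesis
    unfolding row_rank_def_gen by (metis vec.dim_span vec.dim_subset)
qed

lemma rank_mult_le_left: "rank (A ** B :: 'a::field^'n^'m) \<le> rank (A :: 'a^'k^'m)"
proof -
  have lin: "Vector_Spaces.linear (*s) (*s) (\<lambda>v. v v* B)"
    by unfold_locales (auto simp: vec_eq_iff vector_matrix_mult_def sum.distrib sum_distrib_left algebra_simps)
  have "rows (A ** B) = (\<lambda>v. v v* B) ` rows A"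
    by (auto simp: rows_def row_def vec_eq_iff vector_matrix_mult_def matrix_matrix_mult_def image_iff mult.commute)
  then show ?thesis
    unfolding row_rank_def_gen using vec.dim_image_le[OF lin] by simp
qed

lemma rank_invertible_mult:
  fixes A :: "'a::field^'n^'n"
  assumes "invertible A" shows "rank (A ** B) = rank B" "rank (B ** A) = rank B"
proof -
  obtain A' where A': "A' ** A = mat 1" "A ** A' = mat 1" using assms by (auto simp: invertible_def)
  have "rank B = rank (A' ** (A ** B))" by (simp add: matrix_mul_assoc A')
  then show "rank (A ** B) = rank B" by (metis antisym rank_mult_le_right)
  have "rank B = rank ((B ** A) ** A')" by (simp add: matrix_mul_assoc[symmetric] A')
  then show "rank (B ** A) = rank B" by (metis antisym rank_mult_le_left)
qed

lemma rank_diagm: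
  "rank (diagm l :: complex^'n^'n) = card {i. l $ i \<noteq> 0}"
proof -
  let ?I = "{i. l $ i \<noteq> 0}"
  let ?B = "(\<lambda>i. axis i 1 :: complex^'n) ` ?I"
  have row: "row i (diagm l) = complex_of_real (l $ i) *s axis i 1" for i
    by (simp add: row_def diagm_def vec_eq_iff axis_def)
  have inj: "inj_on (\<lambda>i. axis i 1 :: complex^'n) ?I"
    by (auto simp: inj_on_def axis_eq_axis)
  have "vec.span (rows (diagm l)) = vec.span ?B"
  proof (rule vec.span_eq[THEN iffD2], intro conjI subsetI)
    fix v assume "v \<in> rows (diagm l)"
    then obtain i where v: "v = complex_of_real (l $ i) *s axis i 1" by (auto simp: rows_def row)
    show "v \<in> vec.span ?B"
    proof (cases "l $ i = 0")
      case True then show ?thesis by (simp add: v vec.span_zero)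
    next
      case False then show ?thesis unfolding v by (intro vec.span_scale vec.span_base) auto
    qed
  next
    fix v assume "v \<in> ?B"
    then obtain i where i: "l $ i \<noteq> 0" "v = axis i 1" by auto
    have "v = (1 / complex_of_real (l $ i)) *s row i (diagm l)"
      using i by (simp add: row vec_eq_iff)
    also have "\<dots> \<in> vec.span (rows (diagm l))"
      by (intro vec.span_scale vec.span_base) (auto simp: rows_def)
    finally show "v \<in> vec.span (rows (diagm l))" .
  qed
  moreover have "vec.independent ?B"
    by (rule vec.independent_mono[OF independent_cart_basis]) (auto simp: cart_basis_def)
  ultimately have "rank (diagm l :: complex^'n^'n) = card ?B"
    unfolding row_rank_def_gen by (metis vec.dim_span vec.dim_eq_card_independent)
  then show ?thesis by (simp add: card_image[OF inj])
qed

section \<open>Openness of invertibility and lower semicontinuity of the rank\<close>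

lemma bounded_bilinear_matrix_mult:
  "bounded_bilinear ((**) :: complex^'n^'m \<Rightarrow> complex^'k^'n \<Rightarrow> complex^'k^'m)"
proof -
  have "(A + A') ** B = A ** B + A' ** B" "A ** (B + B') = A ** B + A ** B'"
    for A A' :: "complex^'n^'m" and B B' :: "complex^'k^'n"
    by (simp_all add: matrix_matrix_mult_def vec_eq_iff sum.distrib algebra_simps)
  moreover have "(c *\<^sub>R A) ** B = c *\<^sub>R (A ** B)" "A ** (c *\<^sub>R B) = c *\<^sub>R (A ** B)"
    for c and A :: "complex^'n^'m" and B :: "complex^'k^'n"
    by (simp_all add: matrix_matrix_mult_def vec_eq_iff scaleR_sum_right)
  ultimately have "bilinear ((**) :: complex^'n^'m \<Rightarrow> complex^'k^'n \<Rightarrow> complex^'k^'m)"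
    by (simp add: bilinear_def linear_iff)
  then show ?thesis by (simp add: bilinear_conv_bounded_bilinear)
qed

interpretation matrix_mult:
  bounded_bilinear "(**) :: complex^'n^'m \<Rightarrow> complex^'k^'n \<Rightarrow> complex^'k^'m"
  by (rule bounded_bilinear_matrix_mult)

lemma continuous_det:
  "continuous_on UNIV (det :: complex^'n^'n \<Rightarrow> complex)"
  unfolding det_def by (intro continuous_intros)

lemma invertible_nearby:
  fixes A :: "complex^'n^'n"
  assumes "invertible A"
  shows "\<exists>e>0. \<forall>B. norm (B - A) < e \<longrightarrow> invertible B"
proof -
  have "open {B. det B \<noteq> (0::complex)}"
    using open_Collect_neq[OF continuous_det continuous_on_const] .
  moreover have "A \<in> {B. det B \<noteq> 0}" using assms invertible_det_nz by auto
  ultimately obtain e where "e > 0" "ball A e \<subseteq> {B. det B \<noteq> 0}"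
    by (auto simp: open_contains_ball)
  then show ?thesis
    by (intro exI[of _ e]) (auto simp: subset_iff dist_norm norm_minus_commute invertible_det_nz)
qed

text \<open>A linear map that chooses preimages on the range of \<open>A\<close> is such a
  \<open>G\<close>.\<close>

lemma generalized_inverse_exists:
  fixes A :: "'a::field^'n^'n"
  shows "\<exists>G. A ** G ** A = A"
proof -
  obtain g where g: "Vector_Spaces.linear (*s) (*s) g" "\<forall>v\<in>range ((*v) A). A *v g v = v"
    using vec.linear_exists_right_inverse_on[of "(*v) A" UNIV] by auto
  have "A ** matrix g ** A = A"
    by (simp add: matrix_eq matrix_vector_mul_assoc[symmetric] matrix_works[OF g(1)] g(2))
  then show ?thesis by blast
qed

text \<open>For a generalized inverse \<open>G\<close> of \<open>A\<close> and \<open>M = I + G (B - A)\<close>, the identity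
  \<open>G A M = G A G B\<close> turns invertibility of \<open>M\<close> into \<open>rank A \<le> rank B\<close>.\<close>
lemma rank_lower_semicontinuous:
  fixes A :: "complex^'n^'n"
  shows "\<exists>e>0. \<forall>B. norm (B - A) < e \<longrightarrow> rank A \<le> rank B"
proof -
  obtain G where G: "A ** G ** A = A" using generalized_inverse_exists by blast
  have inv1: "invertible (mat 1 :: complex^'n^'n)"
    by (auto simp: invertible_def intro: exI[of _ "mat 1"])
  obtain e where e: "e > 0" "\<And>B :: complex^'n^'n. norm (B - mat 1) < e \<Longrightarrow> invertible B"
    using invertible_nearby[OF inv1] by blast
  obtain K where K: "K > 0" "\<And>X. norm (G ** X) \<le> norm (X :: complex^'n^'n) * K"
    using bounded_linear.pos_bounded[OF matrix_mult.bounded_linear_right] by blast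
  have "rank A \<le> rank B" if "norm (B - A) < e / K" for B
  proof -
    let ?M = "mat 1 + G ** (B - A)"
    have "norm (G ** (B - A)) < e"
      using K(2)[of "B - A"] that K(1) by (simp add: field_simps)
    then have inv: "invertible ?M" by (intro e(2)) simp
    have "(G ** A) ** ?M = (G ** A) ** (G ** B)"
      by (simp add: matrix_mult.add_right matrix_mult.diff_right matrix_mul_assoc)
        (simp add: matrix_mul_assoc[symmetric], simp add: G matrix_mul_assoc)
    then have "rank (G ** A) = rank ((G ** A) ** (G ** B))"
      using rank_invertible_mult(2)[OF inv] by metis
    also have "\<dots> \<le> rank B"
      by (meson order_trans rank_mult_le_right)
    finally have "rank (G ** A) \<le> rank B" .
    moreover have "rank A \<le> rank (G ** A)"
      using rank_mult_le_right[of A "G ** A"] G by (simp add: matrix_mul_assoc)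
    ultimately show ?thesis by simp
  qed
  then show ?thesis using e(1) K(1) by (intro exI[of _ "e / K"]) auto
qed

lemma open_rank_ge: "open {A :: complex^'n^'n. k \<le> rank A}"
proof (rule openI)
  fix A :: "complex^'n^'n" assume "A \<in> {A. k \<le> rank A}"
  then have k: "k \<le> rank A" by simp
  obtain e where "e > 0" "\<And>B. norm (B - A) < e \<Longrightarrow> rank A \<le> rank B"
    using rank_lower_semicontinuous[of A] by blast
  with k show "\<exists>e>0. ball A e \<subseteq> {A. k \<le> rank A}"
    by (intro exI[of _ e]) (auto simp: dist_norm norm_minus_commute subset_iff dest: order_trans)
qed

text \<open>An integer-valued lower semicontinuous function has level sets that are differences of
  two open sets. This makes the event of the main theorem measurable.\<close>

lemma measurable_rank [measurable]:
  "(rank :: complex^'n^'n \<Rightarrow> nat) \<in> borel \<rightarrow>\<^sub>M count_space UNIV"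
proof -
  have "(rank -` {k} \<inter> space borel :: (complex^'n^'n) set)
      = {A. k \<le> rank A} - {A. Suc k \<le> rank A}" for k
    by auto
  moreover have "{A :: complex^'n^'n. k \<le> rank A} - {A. Suc k \<le> rank A} \<in> sets borel" for k
    by (intro sets.Diff borel_open open_rank_ge)
  ultimately show ?thesis
    by (subst measurable_count_space_eq2_countable) auto
qed

section \<open>Positive semidefinite matrices\<close>

lemma adjm_mult: "adjm (A ** B) = adjm B ** adjm A"
  by (simp add: adjm_def matrix_matrix_mult_def vec_eq_iff mult.commute)

lemma adjm_simps [simp]:
  "adjm (adjm A) = A" "adjm (A + B) = adjm A + adjm B" "adjm (A - B) = adjm A - adjm B"
  "adjm (c *\<^sub>R A) = c *\<^sub>R adjm A" "adjm 0 = 0" "adjm (mat 1) = mat 1" "adjm (diagm l) = diagm l"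
  by (auto simp: adjm_def vec_eq_iff mat_def diagm_def)

text \<open>The trace form is the Euclidean inner product of the real and imaginary parts of all
  entries, so projections, norms and Cauchy-Schwarz apply to matrices directly.\<close>

lemma ipS_eq_inner: "ipS X Y = X \<bullet> Y"
proof -
  have "ipS X Y = (\<Sum>i\<in>UNIV. \<Sum>k\<in>UNIV. Re (cnj (X $ k $ i) * Y $ k $ i))"
    by (simp add: ipS_def trace_def adjm_def matrix_matrix_mult_def)
  also have "\<dots> = (\<Sum>k\<in>UNIV. \<Sum>i\<in>UNIV. Re (cnj (X $ k $ i) * Y $ k $ i))"
    by (rule sum.swap)
  finally show ?thesis by (simp add: inner_vec_def inner_complex_def)
qed

lemma inner_adjm_adjm: "adjm X \<bullet> adjm Y = X \<bullet> Y"
  by (simp add: inner_vec_def inner_complex_def adjm_def) (rule sum.swap)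

lemma inner_eq_trace: "X \<bullet> Y = Re (trace (adjm X ** Y))" for X Y :: "complex^'n^'n"
  by (simp add: ipS_eq_inner[symmetric] ipS_def)

lemma inner_mult_left: "(A ** X) \<bullet> Y = X \<bullet> (adjm A ** Y)" for A X Y :: "complex^'n^'n"
  by (simp add: inner_eq_trace adjm_mult matrix_mul_assoc)

lemma inner_mult_right: "(X ** A) \<bullet> Y = X \<bullet> (Y ** adjm A)" for A X Y :: "complex^'n^'n"
  using inner_mult_left[of "adjm A" "adjm X" "adjm Y"]
  by (metis adjm_mult adjm_simps(1) inner_adjm_adjm)

text \<open>The sesquilinear product, conjugate linear in the first slot. Its real part
  \<open>\<bullet>\<close> is homogeneous for real scalars only, while rank-one peeling moves
  complex ones.\<close>

definition cin :: "complex^'n \<Rightarrow> complex^'n \<Rightarrow> complex" where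
  "cin u v = (\<Sum>i\<in>UNIV. cnj (u $ i) * v $ i)"

lemma inner_eq_cin: "u \<bullet> v = Re (cin u v)"
  by (simp add: cin_def inner_vec_def inner_complex_def)

lemma cin_cnj: "cnj (cin u v) = cin v u"
  by (simp add: cin_def mult.commute)

lemma cin_scale [simp]: "cin (c *s u) v = cnj c * cin u v" "cin u (c *s v) = c * cin u v"
  by (simp_all add: cin_def sum_distrib_left algebra_simps)

lemma cin_zero [simp]: "cin u 0 = 0" "cin 0 u = 0"
  by (simp_all add: cin_def)

lemma cin_matrix: "cin u (A *v v) = cin (adjm A *v u) v"
proof -
  have "cin u (A *v v) = (\<Sum>i\<in>UNIV. \<Sum>j\<in>UNIV. cnj (u $ i) * A $ i $ j * v $ j)"
    by (simp add: cin_def matrix_vector_mult_def sum_distrib_left mult.assoc)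
  also have "\<dots> = (\<Sum>j\<in>UNIV. \<Sum>i\<in>UNIV. cnj (u $ i) * A $ i $ j * v $ j)"
    by (rule sum.swap)
  also have "\<dots> = cin (adjm A *v u) v"
    by (simp add: cin_def matrix_vector_mult_def adjm_def sum_distrib_left mult_ac)
  finally show ?thesis .
qed

lemma inner_matrix_vector: "u \<bullet> (A *v v) = (adjm A *v u) \<bullet> v"
  by (simp add: inner_eq_cin cin_matrix)

lemma qform_eq_inner: "Re (qform v X) = v \<bullet> (X *v v)"
  by (simp add: qform_def inner_eq_cin cin_def)

lemma linear_matrix_vector: "linear ((*v) (A :: complex^'n^'m))"
  by (rule linearI)
    (auto simp: matrix_vector_mult_def vec_eq_iff sum.distrib algebra_simps scaleR_sum_right)

lemma matrix_vector_scaleR: "(c *\<^sub>R A) *v v = c *\<^sub>R (A *v (v :: complex^'n))"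
  by (simp add: matrix_vector_mult_def vec_eq_iff scaleR_sum_right)

text \<open>Positive semidefiniteness tested on all complex vectors; on \<open>SymK rc\<close> it agrees with
  \<open>psdK rc\<close> in both cases, so the real case needs no separate treatment below.\<close>
definition psdC :: "complex^'n^'n \<Rightarrow> bool" where
  "psdC X \<longleftrightarrow> adjm X = X \<and> (\<forall>v. 0 \<le> v \<bullet> (X *v v))"

definition re_vec :: "complex^'n \<Rightarrow> complex^'n" where
  "re_vec v = (\<chi> i. complex_of_real (Re (v $ i)))"

definition im_vec :: "complex^'n \<Rightarrow> complex^'n" where
  "im_vec v = (\<chi> i. complex_of_real (Im (v $ i)))"

lemma vec_in_K_re_im: "vec_in_K rc (re_vec v)" "vec_in_K rc (im_vec v)"
  by (auto simp: vec_in_K_def Kset_def re_vec_def im_vec_def)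

lemma re_im_vec_eq_0: "re_vec v = 0 \<Longrightarrow> im_vec v = 0 \<Longrightarrow> v = 0"
  by (auto simp: vec_eq_iff re_vec_def im_vec_def complex_eq_iff)

text \<open>For real \<open>X\<close> the mixed terms between \<open>re_vec v\<close> and
  \<open>im_vec v\<close> are purely imaginary and drop out of the real part.\<close>

lemma inner_real_matrix:
  assumes "entries_in_K True X"
  shows "v \<bullet> (X *v v) = re_vec v \<bullet> (X *v re_vec v) + im_vec v \<bullet> (X *v im_vec v)"
proof -
  have "Im (X $ i $ j) = 0" for i j
    using assms by (auto simp: entries_in_K_def Kset_def image_iff) (metis Im_complex_of_real)
  then show ?thesis
    by (simp add: inner_vec_def inner_complex_def matrix_vector_mult_def re_vec_def im_vec_def sum.distrib)
qed

lemma psdK_iff: "psdK rc X \<longleftrightarrow> X \<in> SymK rc \<and> psdC X"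
proof
  assume *: "psdK rc X"
  have "0 \<le> v \<bullet> (X *v v)" for v
  proof (cases rc)
    case True
    then have "entries_in_K True X" using * by (simp add: psdK_def SymK_def)
    then show ?thesis using * by (simp add: psdK_def qform_eq_inner inner_real_matrix[of X v] vec_in_K_re_im)
  next
    case False
    then show ?thesis using * by (simp add: psdK_def qform_eq_inner vec_in_K_def Kset_def)
  qed
  then show "X \<in> SymK rc \<and> psdC X" using * by (simp add: psdK_def psdC_def SymK_def)
qed (simp add: psdK_def psdC_def qform_eq_inner)

text \<open>The set \<open>I\<close> lets one transfer to complex vectors serve both
  \<open>pdK\<close> (with \<open>I\<close> empty) and \<open>block_pd\<close> (with
  \<open>I\<close> the indices of nonzero eigenvalues).\<close>

lemma inner_pos_if_pos_on_K:
  assumes X: "X \<in> SymK rc"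
    and pos: "\<And>v. vec_in_K rc v \<Longrightarrow> v \<noteq> 0 \<Longrightarrow> (\<forall>i\<in>I. v $ i = 0) \<Longrightarrow> 0 < Re (qform v X)"
    and v: "v \<noteq> 0" "\<forall>i\<in>I. v $ i = 0"
  shows "0 < v \<bullet> (X *v v)"
proof (cases rc)
  case True
  then have real: "entries_in_K True X" using X by (simp add: SymK_def)
  have pos': "0 < u \<bullet> (X *v u)" if "u \<in> {re_vec v, im_vec v}" "u \<noteq> 0" for u
    unfolding qform_eq_inner[symmetric] using that v(2)
    by (intro pos) (auto simp: vec_in_K_re_im, auto simp: re_vec_def im_vec_def)
  have "0 \<le> u \<bullet> (X *v u)" if "u \<in> {re_vec v, im_vec v}" for u
    using pos'[OF that] by (cases "u = 0") auto
  moreover have "re_vec v \<noteq> 0 \<or> im_vec v \<noteq> 0" using v re_im_vec_eq_0 by blast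
  ultimately show ?thesis
    unfolding inner_real_matrix[OF real, of v] using pos' by (metis add_nonneg_pos add_pos_nonneg insertI1 insertI2)
next
  case False
  then show ?thesis using pos[of v] v by (simp add: qform_eq_inner vec_in_K_def Kset_def)
qed

lemma pdK_imp_pos: "pdK rc X \<Longrightarrow> v \<noteq> 0 \<Longrightarrow> 0 < v \<bullet> (X *v v)"
  by (rule inner_pos_if_pos_on_K[where rc = rc and I = "{}"]) (auto simp: pdK_def)

text \<open>The form attains a positive minimum on the compact unit sphere; homogeneity extends the
  bound.\<close>

lemma pdK_lower_bound:
  assumes "pdK rc (X :: complex^'n^'n)"
  shows "\<exists>c>0. \<forall>v. c * (norm v)\<^sup>2 \<le> v \<bullet> (X *v v)"
proof -
  let ?S = "sphere 0 1 :: (complex^'n) set"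
  have "axis undefined 1 \<in> ?S" by simp
  then have ne: "?S \<noteq> {}" by blast
  have "continuous_on ?S (\<lambda>v. v \<bullet> (X *v v))"
    by (intro continuous_intros linear_continuous_on linear_conv_bounded_linear[THEN iffD1] linear_matrix_vector)
  from continuous_attains_inf[OF compact_sphere ne this]
  obtain u where u: "norm u = 1" "\<And>v. norm v = 1 \<Longrightarrow> u \<bullet> (X *v u) \<le> v \<bullet> (X *v v)"
    by auto
  have "u \<noteq> 0" using u(1) by auto
  have "(u \<bullet> (X *v u)) * (norm v)\<^sup>2 \<le> v \<bullet> (X *v v)" for v
  proof (cases "v = 0")
    case False
    let ?w = "(1 / norm v) *\<^sub>R v"
    have "u \<bullet> (X *v u) \<le> ?w \<bullet> (X *v ?w)" using False by (intro u(2)) simp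
    also have "\<dots> = (v \<bullet> (X *v v)) / (norm v)\<^sup>2"
      by (simp add: linear_scale[OF linear_matrix_vector] power2_eq_square)
    finally show ?thesis using False by (simp add: field_simps)
  qed simp
  then show ?thesis using pdK_imp_pos[OF assms \<open>u \<noteq> 0\<close>] by blast
qed

text \<open>The quadratic has slope \<open>a\<close> at 0. The first-order conditions below are
  extracted in this form.\<close>

lemma linear_coeff_nonneg:
  fixes a b t0 :: real
  assumes "t0 > 0" "\<And>t. 0 < t \<Longrightarrow> t \<le> t0 \<Longrightarrow> 0 \<le> t * a + t\<^sup>2 * b"
  shows "0 \<le> a"
proof (rule ccontr)
  assume "\<not> 0 \<le> a"
  \<comment> \<open>Small enough that \<open>t * \<bar>b\<bar>\<close> is at most half of
    \<open>- a\<close>; the \<open>+ 1\<close> avoids division by zero.\<close>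
  define t where "t = min t0 (- a / (2 * (\<bar>b\<bar> + 1)))"
  have t: "0 < t" "t \<le> t0" using assms(1) \<open>\<not> 0 \<le> a\<close> by (auto simp: t_def field_simps)
  have "t * (\<bar>b\<bar> + 1) \<le> - a / 2"
  proof -
    have "t \<le> - a / (2 * (\<bar>b\<bar> + 1))" by (simp add: t_def)
    then show ?thesis by (simp add: field_simps)
  qed
  moreover have "t * b \<le> t * (\<bar>b\<bar> + 1)" using t by (intro mult_left_mono) auto
  ultimately have "a + t * b < 0" using \<open>\<not> 0 \<le> a\<close> by linarith
  then have "t * (a + t * b) < 0" using t(1) by (simp add: mult_pos_neg)
  then show False using assms(2)[OF t] by (simp add: power2_eq_square algebra_simps)
qed

text \<open>Moving from \<open>w\<close> to \<open>w - t X w\<close> changes the form by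
  \<open>- 2 t |X w|^2 + O(t^2)\<close>. It must stay nonnegative, which forces
  \<open>X w = 0\<close>.\<close>

lemma psdC_kernel:
  assumes X: "psdC X" and w: "w \<bullet> (X *v w) = 0" shows "X *v w = 0"
proof -
  let ?u = "X *v w"
  have "0 \<le> - 2 * (?u \<bullet> ?u)"
  proof (rule linear_coeff_nonneg[of 1 _ "?u \<bullet> (X *v ?u)"])
    fix t :: real
    have "w \<bullet> (X *v ?u) = ?u \<bullet> ?u"
      using X inner_matrix_vector[of w X ?u] by (simp add: psdC_def)
    moreover have "0 \<le> (w - t *\<^sub>R ?u) \<bullet> (X *v (w - t *\<^sub>R ?u))"
      using X by (simp add: psdC_def)
    ultimately show "0 \<le> t * (- 2 * (?u \<bullet> ?u)) + t\<^sup>2 * (?u \<bullet> (X *v ?u))"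
      by (simp add: linear_scale[OF linear_matrix_vector] linear_diff[OF linear_matrix_vector] w
          inner_diff_left inner_diff_right power2_eq_square algebra_simps)
  qed simp
  then have "?u \<bullet> ?u \<le> 0" by simp
  then show ?thesis by (metis inner_eq_zero_iff inner_ge_zero order_antisym)
qed

section \<open>Rank-one matrices and the inner product of two semidefinite matrices\<close>

definition outer :: "complex^'n \<Rightarrow> complex^'n^'n" where
  "outer u = (\<chi> i j. u $ i * cnj (u $ j))"

lemma adjm_outer [simp]: "adjm (outer u) = outer u"
  by (simp add: adjm_def outer_def vec_eq_iff mult.commute)

lemma outer_mult_vec: "outer u *v v = cin u v *s u"
  by (simp add: outer_def cin_def matrix_vector_mult_def vec_eq_iff sum_distrib_left mult_ac)

lemma inner_outer: "S \<bullet> outer u = u \<bullet> (S *v u)"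
  by (simp add: inner_eq_cin cin_def inner_vec_def inner_complex_def outer_def matrix_vector_mult_def
      sum_distrib_left sum_distrib_right algebra_simps flip: sum.distrib)

text \<open>Without a spectral theorem: if \<open>u = X w \<noteq> 0\<close> and \<open>c = w\<^sup>* X w\<close>, then
  \<open>X - u u\<^sup>* / c\<close> is again positive semidefinite and has a strictly larger kernel, so that
  peeling off rank-one terms terminates.\<close>
lemma psdC_inner_nonneg:
  fixes S X :: "complex^'n^'n"
  assumes S: "psdC S" and "psdC X" shows "0 \<le> S \<bullet> X"
  using assms(2)
proof (induction "DIM(complex^'n) - dim {v. X *v v = 0}" arbitrary: X rule: less_induct)
  case less
  note X = less.prems
  have herm: "adjm X = X" using X by (simp add: psdC_def)
  show ?case
  proof (cases "X = 0")
    case False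
    then obtain w where w: "X *v w \<noteq> 0" by (metis matrix_eq matrix_vector_mult_0)
    define u c where "u = X *v w" and "c = w \<bullet> u"
    have c: "c > 0"
      using psdC_kernel[OF X] w X unfolding c_def u_def psdC_def by (metis order_le_less)
    have cin_u: "cin u v = cin w (X *v v)" for v
      by (simp add: u_def cin_matrix herm)
    have cuw: "cin u w = complex_of_real c"
      using cin_u[of w] cin_cnj[of u w] by (auto simp: complex_eq_iff c_def inner_eq_cin u_def)
    define X' where "X' = X - (1 / c) *\<^sub>R outer u"
    have X'v: "X' *v v = X *v v - (1 / c) *\<^sub>R (cin u v *s u)" for v
      by (simp add: X'_def matrix_vector_mult_diff_rdistrib matrix_vector_scaleR outer_mult_vec)
    have "psdC X'"
      unfolding psdC_def
    proof (intro conjI allI)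
      show "adjm X' = X'" by (simp add: X'_def herm)
      fix v
      \<comment> \<open>\<open>t *s w\<close> is the projection of \<open>v\<close> onto
        \<open>w\<close> in the form of \<open>X\<close>; the form of \<open>X\<close> at the
        remainder \<open>v - t *s w\<close> equals the form of \<open>X'\<close> at
        \<open>v\<close>.\<close>
      define t where "t = cin u v / complex_of_real c"
      have cuv: "cin u v = t * complex_of_real c" using c by (simp add: t_def)
      have norm_t: "t * cnj t = complex_of_real ((cmod t)\<^sup>2)"
        by (rule complex_norm_square[symmetric])
      have cvu: "cin v u = cnj t * complex_of_real c"
        by (subst cin_cnj[symmetric]) (simp add: cuv)
      have cwu: "cin w u = complex_of_real c"
        by (subst cin_cnj[symmetric]) (simp add: cuw)
      have cwXv: "cin w (X *v v) = t * complex_of_real c"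
        by (simp add: cin_u[symmetric] cuv)
      have "v \<bullet> (t *s u) = Re ((t * cnj t) * complex_of_real c)"
        by (simp only: inner_eq_cin cin_scale cvu mult.assoc)
      then have e1: "v \<bullet> (t *s u) = (cmod t)\<^sup>2 * c"
        unfolding norm_t by simp
      have "(t *s w) \<bullet> (X *v v) = Re ((t * cnj t) * complex_of_real c)"
        by (simp only: inner_eq_cin cin_scale cwXv mult.assoc mult.left_commute)
      then have e2: "(t *s w) \<bullet> (X *v v) = (cmod t)\<^sup>2 * c"
        unfolding norm_t by simp
      have "(t *s w) \<bullet> (t *s u) = Re ((t * cnj t) * complex_of_real c)"
        by (simp only: inner_eq_cin cin_scale cwu mult.assoc mult.left_commute)
      then have e3: "(t *s w) \<bullet> (t *s u) = (cmod t)\<^sup>2 * c"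
        unfolding norm_t by simp
      have "0 \<le> (v - t *s w) \<bullet> (X *v (v - t *s w))" using X by (simp add: psdC_def)
      also have "X *v (v - t *s w) = X *v v - t *s u"
        by (simp add: matrix_vector_mult_diff_distrib u_def vec.linear_scale[OF matrix_vector_mul_linear_gen])
      also have "(v - t *s w) \<bullet> (X *v v - t *s u) = v \<bullet> (X *v v) - (cmod t)\<^sup>2 * c"
        by (simp only: inner_diff_left inner_diff_right e1 e2 e3)
      also have "\<dots> = v \<bullet> (X' *v v)"
      proof -
        have "v \<bullet> (cin u v *s u) = (cmod t)\<^sup>2 * c * c"
        proof -
          have "cin u v *s u = c *\<^sub>R (t *s u)"
            by (simp add: cuv vec_eq_iff scaleR_conv_of_real[where 'a=complex] mult_ac)
          then show ?thesis by (simp add: e1)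
        qed
        then show ?thesis using c by (simp add: X'v inner_diff_right)
      qed
      finally show "0 \<le> v \<bullet> (X' *v v)" .
    qed
    have sub: "subspace {v. Y *v v = 0}" for Y :: "complex^'n^'n"
      by (rule linear_subspace_kernel[OF linear_matrix_vector])
    have "{v. X *v v = 0} \<subset> {v. X' *v v = 0}"
    proof
      show "{v. X *v v = 0} \<subseteq> {v. X' *v v = 0}"
        by (auto simp: X'v cin_u)
      have "X' *v w = 0"
        using c by (simp add: X'v cuw vec_eq_iff scaleR_conv_of_real[where 'a=complex] u_def[symmetric])
      then show "{v. X *v v = 0} \<noteq> {v. X' *v v = 0}" using w by auto
    qed
    then have "dim {v. X *v v = 0} < dim {v. X' *v v = 0}"
      by (intro dim_psubset) (simp add: span_eq_iff[THEN iffD2, OF sub])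
    moreover have "dim {v. X' *v v = 0} \<le> DIM(complex^'n)" by (rule dim_subset_UNIV)
    ultimately have "0 \<le> S \<bullet> X'" by (intro less.hyps \<open>psdC X'\<close>) linarith
    moreover have "0 \<le> S \<bullet> outer u" using S by (simp add: inner_outer psdC_def)
    moreover have "S \<bullet> X = S \<bullet> X' + (1 / c) * (S \<bullet> outer u)"
      by (simp add: X'_def inner_diff_right)
    ultimately show ?thesis using c by simp
  qed simp
qed

lemma psdC_congruence:
  assumes "psdC X" shows "psdC (adjm A ** X ** A)"
proof -
  have "v \<bullet> ((adjm A ** X ** A) *v v) = (A *v v) \<bullet> (X *v (A *v v))" for v
    by (simp add: matrix_vector_mul_assoc[symmetric] inner_matrix_vector[of v "adjm A"])
  then show ?thesis using assms by (simp add: psdC_def adjm_mult matrix_mul_assoc)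
qed

lemma psdC_add: "psdC X \<Longrightarrow> psdC Y \<Longrightarrow> psdC (X + Y)"
  by (simp add: psdC_def matrix_vector_mult_add_rdistrib inner_add_right)

lemma psdC_scaleR: "psdC X \<Longrightarrow> 0 \<le> c \<Longrightarrow> psdC (c *\<^sub>R X)"
  by (simp add: psdC_def matrix_vector_scaleR)

text \<open>\<open>(I + t W)\<^sup>* X (I + t W)\<close> exceeds \<open>X + t (X W + W\<^sup>* X)\<close> by a term of order \<open>t\<^sup>2\<close>,
  which a multiple of order \<open>t\<^sup>2\<close> of the Slater point \<open>X0\<close> compensates.\<close>
lemma psdC_perturb_tangent:
  fixes X X0 W :: "complex^'n^'n"
  assumes X: "psdC X" and X0: "pdK rc X0"
  shows "\<exists>\<kappa>\<ge>0. \<forall>t. \<kappa> * t\<^sup>2 \<le> 1 \<longrightarrow>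
    psdC ((1 - \<kappa> * t\<^sup>2) *\<^sub>R (X + t *\<^sub>R (X ** W + adjm W ** X)) + (\<kappa> * t\<^sup>2) *\<^sub>R X0)"
proof -
  obtain c where c: "c > 0" "\<And>v. c * (norm v)\<^sup>2 \<le> v \<bullet> (X0 *v v)"
    using pdK_lower_bound[OF X0] by blast
  let ?V = "adjm W ** X ** W"
  obtain K where K: "K > 0" "\<And>v. norm (?V *v v) \<le> K * norm v"
    using linear_bounded_pos[OF linear_matrix_vector] by blast
  have V: "v \<bullet> (?V *v v) \<le> K * (norm v)\<^sup>2" for v
  proof -
    have "v \<bullet> (?V *v v) \<le> norm v * norm (?V *v v)" by (rule norm_cauchy_schwarz)
    also have "\<dots> \<le> norm v * (K * norm v)" by (intro mult_left_mono K(2)) simp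
    finally show ?thesis by (simp add: power2_eq_square mult_ac)
  qed
  have "psdC ((1 - K / c * t\<^sup>2) *\<^sub>R (X + t *\<^sub>R (X ** W + adjm W ** X)) + (K / c * t\<^sup>2) *\<^sub>R X0)"
    if t: "K / c * t\<^sup>2 \<le> 1" for t
    unfolding psdC_def
  proof (intro conjI allI)
    let ?s = "K / c * t\<^sup>2"
    have "adjm X = X" "adjm X0 = X0" using X X0 by (auto simp: psdC_def pdK_def SymK_def)
    then show "adjm ((1 - ?s) *\<^sub>R (X + t *\<^sub>R (X ** W + adjm W ** X)) + ?s *\<^sub>R X0)
        = (1 - ?s) *\<^sub>R (X + t *\<^sub>R (X ** W + adjm W ** X)) + ?s *\<^sub>R X0"
      by (simp add: adjm_mult add.commute)
    fix v
    let ?A = "mat 1 + t *\<^sub>R W"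
    have "adjm ?A ** X ** ?A = X + t *\<^sub>R (X ** W + adjm W ** X) + t\<^sup>2 *\<^sub>R ?V"
      by (simp add: matrix_mult.add_left matrix_mult.add_right matrix_mult.scaleR_left
          matrix_mult.scaleR_right matrix_mul_assoc power2_eq_square scaleR_right_distrib)
    then have "0 \<le> v \<bullet> ((X + t *\<^sub>R (X ** W + adjm W ** X) + t\<^sup>2 *\<^sub>R ?V) *v v)"
      using psdC_congruence[OF X, of ?A] by (simp add: psdC_def)
    then have "- (t\<^sup>2 * (K * (norm v)\<^sup>2)) \<le> v \<bullet> ((X + t *\<^sub>R (X ** W + adjm W ** X)) *v v)"
      using mult_left_mono[OF V[of v], of "t\<^sup>2"]
      by (simp add: matrix_vector_mult_add_rdistrib matrix_vector_scaleR inner_add_right)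
    then have "(1 - ?s) * - (t\<^sup>2 * (K * (norm v)\<^sup>2))
        \<le> (1 - ?s) * (v \<bullet> ((X + t *\<^sub>R (X ** W + adjm W ** X)) *v v))"
      using t by (intro mult_left_mono) auto
    moreover have "?s * (c * (norm v)\<^sup>2) \<le> ?s * (v \<bullet> (X0 *v v))"
      using c K by (intro mult_left_mono) auto
    \<comment> \<open>Here \<open>\<kappa> = K / c\<close> is explained:
      \<open>?s * c = K t^2\<close>, so the two bounds combine to \<open>?s * t^2 * K |v|^2\<close>,
      which is nonnegative.\<close>
    moreover have "0 \<le> (1 - ?s) * - (t\<^sup>2 * (K * (norm v)\<^sup>2)) + ?s * (c * (norm v)\<^sup>2)"
    proof -
      have "?s * (c * (norm v)\<^sup>2) = t\<^sup>2 * (K * (norm v)\<^sup>2)" using c by simp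
      then have "(1 - ?s) * - (t\<^sup>2 * (K * (norm v)\<^sup>2)) + ?s * (c * (norm v)\<^sup>2) = ?s * (t\<^sup>2 * (K * (norm v)\<^sup>2))"
        by (simp add: algebra_simps)
      also have "\<dots> \<ge> 0" using c K by simp
      finally show ?thesis .
    qed
    ultimately show "0 \<le> v \<bullet> (((1 - ?s) *\<^sub>R (X + t *\<^sub>R (X ** W + adjm W ** X)) + ?s *\<^sub>R X0) *v v)"
      unfolding matrix_vector_mult_add_rdistrib[of "(1 - ?s) *\<^sub>R _"] matrix_vector_scaleR inner_add_right inner_scaleR_right
      by linarith
  qed
  then show ?thesis using c K by (intro exI[of _ "K / c"]) auto
qed

section \<open>Closure of the real and complex matrix classes; tangent directions\<close>

lemma Kset_closed:
  "x \<in> Kset rc \<Longrightarrow> y \<in> Kset rc \<Longrightarrow> x + y \<in> Kset rc"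
  "x \<in> Kset rc \<Longrightarrow> y \<in> Kset rc \<Longrightarrow> x * y \<in> Kset rc"
  "x \<in> Kset rc \<Longrightarrow> cnj x \<in> Kset rc"
  "complex_of_real c \<in> Kset rc"
  by (auto simp: Kset_def image_iff simp flip: of_real_add of_real_mult)

lemma Kset_sum: "(\<And>i. i \<in> I \<Longrightarrow> f i \<in> Kset rc) \<Longrightarrow> sum f I \<in> Kset rc"
  by (induction I rule: infinite_finite_induct)
    (auto intro: Kset_closed simp: Kset_closed(4)[of 0, simplified])

lemma entries_in_K_closed:
  "entries_in_K rc A \<Longrightarrow> entries_in_K rc B \<Longrightarrow> entries_in_K rc (A + B)"
  "entries_in_K rc A \<Longrightarrow> entries_in_K rc (adjm A)"
  "entries_in_K rc A \<Longrightarrow> entries_in_K rc (c *\<^sub>R A)"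
  by (auto simp: entries_in_K_def adjm_def scaleR_conv_of_real[where 'a=complex] intro: Kset_closed)

lemma entries_in_K_mult:
  "entries_in_K rc A \<Longrightarrow> entries_in_K rc B \<Longrightarrow> entries_in_K rc (A ** B)"
  by (auto simp: entries_in_K_def matrix_matrix_mult_def intro!: Kset_sum Kset_closed(2))

lemma subspace_SymK: "subspace (SymK rc)"
  by (auto simp: subspace_def SymK_def intro: entries_in_K_closed)
    (simp add: entries_in_K_def Kset_closed(4)[of 0, simplified])

lemma SymK_congruence:
  "X \<in> SymK rc \<Longrightarrow> entries_in_K rc A \<Longrightarrow> adjm A ** X ** A \<in> SymK rc"
  by (simp add: SymK_def adjm_mult matrix_mul_assoc entries_in_K_mult entries_in_K_closed)

lemma SymK_tangent:
  "X \<in> SymK rc \<Longrightarrow> entries_in_K rc W \<Longrightarrow> X ** W + adjm W ** X \<in> SymK rc"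
  by (simp add: SymK_def adjm_mult entries_in_K_mult entries_in_K_closed add.commute)

text \<open>Both summands contribute equally, since the inner product is invariant under adjoints.
  With \<open>W\<close> the adjoint of \<open>Z ** X\<close> the value is 2 |Z X|^2, so
  orthogonality to all tangent directions at \<open>X\<close> forces
  \<open>Z ** X = 0\<close>.\<close>

lemma inner_tangent:
  assumes "adjm Z = Z" "adjm X = X"
  shows "Z \<bullet> (X ** W + adjm W ** X) = 2 * (adjm (Z ** X) \<bullet> W)"
proof -
  have "Z \<bullet> (X ** W) = adjm (Z ** X) \<bullet> W"
    using inner_mult_left[of X W Z] assms by (simp add: adjm_mult inner_commute)
  moreover have "Z \<bullet> (adjm W ** X) = adjm (adjm (Z ** X)) \<bullet> adjm W"
    using inner_mult_right[of "adjm W" X Z] assms by (simp add: inner_commute)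
  ultimately show ?thesis by (simp add: inner_add_right inner_adjm_adjm del: adjm_simps(1))
qed

section \<open>The limiting problem\<close>

lemma mult_diagm: "(A ** diagm l) $ i $ j = A $ i $ j * complex_of_real (l $ j)"
  and diagm_mult: "(diagm l ** A) $ i $ j = complex_of_real (l $ i) * A $ i $ j"
  and diagm_mult_vec: "(diagm l *v v) $ i = complex_of_real (l $ i) * v $ i"
proof -
  have "(\<Sum>k\<in>UNIV. A $ i $ k * (if k = j then complex_of_real (l $ k) else 0))
      = (\<Sum>k\<in>UNIV. if k = j then A $ i $ k * complex_of_real (l $ k) else 0)"
    by (rule sum.cong) auto
  then show "(A ** diagm l) $ i $ j = A $ i $ j * complex_of_real (l $ j)"
    by (simp add: matrix_matrix_mult_def diagm_def)
  have "(\<Sum>k\<in>UNIV. (if i = k then complex_of_real (l $ i) else 0) * A $ k $ j)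
      = (\<Sum>k\<in>UNIV. if i = k then complex_of_real (l $ i) * A $ k $ j else 0)"
    by (rule sum.cong) auto
  then show "(diagm l ** A) $ i $ j = complex_of_real (l $ i) * A $ i $ j"
    by (simp add: matrix_matrix_mult_def diagm_def)
  have "(\<Sum>k\<in>UNIV. (if i = k then complex_of_real (l $ i) else 0) * v $ k)
      = (\<Sum>k\<in>UNIV. if i = k then complex_of_real (l $ i) * v $ k else 0)"
    by (rule sum.cong) auto
  then show "(diagm l *v v) $ i = complex_of_real (l $ i) * v $ i"
    by (simp add: matrix_vector_mult_def diagm_def)
qed

text \<open>The deterministic data. \<open>L\<close> is the solution of the linear system,
  \<open>X0\<close> a Slater point, and \<open>FX\<close> stands for \<open>F Xbar\<close> as a
  plain matrix; continuity of \<open>F\<close> enters later as closeness of \<open>F Xt\<close> to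
  it.\<close>

locale psd_completion =
  fixes rc :: bool
    and \<Theta> :: "nat \<Rightarrow> ((complex, 'n::{finite,linorder}) vec, 'n) vec"
    and d :: nat and \<alpha> \<beta> :: "nat set" and p :: "nat \<Rightarrow> real"
    and Xbar P :: "((complex, 'n) vec, 'n) vec" and lam :: "(real, 'n) vec" and r :: nat
    and FX L X0 :: "((complex, 'n) vec, 'n) vec"
  assumes basis_in: "k < d \<Longrightarrow> \<Theta> k \<in> SymK rc"
    and basis_orth: "j < d \<Longrightarrow> k < d \<Longrightarrow> \<Theta> j \<bullet> \<Theta> k = (if j = k then 1 else 0)"
    and basis_span: "SymK rc \<subseteq> span (\<Theta> ` {..<d})"
    and alpha: "\<alpha> \<subseteq> {..<d}" and beta: "\<beta> = {..<d} - \<alpha>"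
    and p_pos: "k \<in> \<beta> \<Longrightarrow> 0 < p k" and p_sum: "(\<Sum>k\<in>\<beta>. p k) = 1"
    and Xbar_psd: "psdK rc Xbar" and rank_Xbar: "rank Xbar = r"
    and P: "unitaryK rc P" and lam: "nonincr lam"
    and eig: "Xbar = P ** diagm lam ** adjm P"
    and L: "block_sym rc r L" "lin_system \<Theta> \<beta> p P FX r L" "block_pd rc r L"
    and L_unique: "block_sym rc r L' \<Longrightarrow> lin_system \<Theta> \<beta> p P FX r L' \<Longrightarrow> L' = L"
    and X0: "pdK rc X0" "k \<in> \<alpha> \<Longrightarrow> \<Theta> k \<bullet> X0 = \<Theta> k \<bullet> Xbar"
begin

section \<open>Coordinates in the orthonormal basis\<close>

lemma finite_beta [simp]: "finite \<beta>" and beta_less: "k \<in> \<beta> \<Longrightarrow> k < d"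
  by (auto simp: beta)

lemma p_le_1: "k \<in> \<beta> \<Longrightarrow> p k \<le> 1"
  using member_le_sum[of k \<beta> p] p_pos p_sum by (auto intro: less_imp_le)

lemma Xbar_Sym: "Xbar \<in> SymK rc" and Xbar_psdC: "psdC Xbar"
  using Xbar_psd by (auto simp: psdK_iff)

text \<open>The residual lies in the span of the basis and is orthogonal to every basis element,
  hence to itself.\<close>

lemma Sym_expansion:
  assumes "X \<in> SymK rc" shows "X = (\<Sum>k<d. (\<Theta> k \<bullet> X) *\<^sub>R \<Theta> k)"
proof -
  let ?Y = "X - (\<Sum>k<d. (\<Theta> k \<bullet> X) *\<^sub>R \<Theta> k)"
  have orth: "\<Theta> j \<bullet> ?Y = 0" if "j < d" for j
    using that by (simp add: inner_diff_right inner_sum_right basis_orth if_distrib cong: if_cong)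
  have "?Y \<in> span (\<Theta> ` {..<d})"
    using assms basis_span by (intro span_diff span_sum span_scale) (auto intro: span_base)
  then have "orthogonal ?Y ?Y"
    by (rule orthogonal_to_span) (use orth in \<open>auto simp: orthogonal_def inner_commute[of "X - _"]\<close>)
  then show ?thesis by (simp add: orthogonal_def)
qed

lemma inner_Sym:
  assumes "X \<in> SymK rc" shows "Y \<bullet> X = (\<Sum>k<d. (\<Theta> k \<bullet> Y) * (\<Theta> k \<bullet> X))"
proof -
  have "Y \<bullet> X = Y \<bullet> (\<Sum>k<d. (\<Theta> k \<bullet> X) *\<^sub>R \<Theta> k)"
    using Sym_expansion[OF assms] by (rule arg_cong)
  then show ?thesis by (simp add: inner_sum_right inner_commute[of Y] mult.commute)
qed

lemma inner_beta:
  assumes "X \<in> SymK rc" "\<And>k. k \<in> \<alpha> \<Longrightarrow> \<Theta> k \<bullet> X = 0"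
  shows "Y \<bullet> X = (\<Sum>k\<in>\<beta>. (\<Theta> k \<bullet> Y) * (\<Theta> k \<bullet> X))"
  unfolding inner_Sym[OF assms(1), of Y] beta
  by (rule sum.mono_neutral_right) (auto simp: assms(2))

lemma Sym_eq_iff:
  assumes "X \<in> SymK rc" "Y \<in> SymK rc" "\<And>k. k < d \<Longrightarrow> \<Theta> k \<bullet> X = \<Theta> k \<bullet> Y"
  shows "X = Y"
proof -
  have "X = (\<Sum>k<d. (\<Theta> k \<bullet> X) *\<^sub>R \<Theta> k)" by (rule Sym_expansion[OF assms(1)])
  also have "\<dots> = (\<Sum>k<d. (\<Theta> k \<bullet> Y) *\<^sub>R \<Theta> k)" by (simp add: assms(3))
  also have "\<dots> = Y" by (rule Sym_expansion[OF assms(2), symmetric])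
  finally show ?thesis .
qed

lemma norm_Theta: "k < d \<Longrightarrow> norm (\<Theta> k) = 1"
  by (simp add: norm_eq_sqrt_inner basis_orth)

lemma coef_le_norm: "k < d \<Longrightarrow> \<bar>\<Theta> k \<bullet> X\<bar> \<le> norm X"
  using Cauchy_Schwarz_ineq2[of "\<Theta> k" X] by (simp add: norm_Theta)

lemma Qdag_Sym: "Qdag \<Theta> \<beta> p X \<in> SymK rc"
  unfolding Qdag_def by (intro subspace_sum[OF subspace_SymK] subspace_scale[OF subspace_SymK] basis_in beta_less)

lemma coef_sum_beta:
  "k < d \<Longrightarrow> \<Theta> k \<bullet> (\<Sum>j\<in>\<beta>. c j *\<^sub>R \<Theta> j) = (if k \<in> \<beta> then c k else 0)"
  by (simp add: inner_sum_right basis_orth beta_less if_distrib cong: if_cong)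

lemma coef_Qdag: "k < d \<Longrightarrow> \<Theta> k \<bullet> Qdag \<Theta> \<beta> p X = (if k \<in> \<beta> then (\<Theta> k \<bullet> X) / p k else 0)"
  unfolding Qdag_def ipS_eq_inner by (rule coef_sum_beta)

lemma Qdag_add: "Qdag \<Theta> \<beta> p (X + Y) = Qdag \<Theta> \<beta> p X + Qdag \<Theta> \<beta> p Y"
  by (rule Sym_eq_iff) (simp_all add: Qdag_Sym subspace_add[OF subspace_SymK] coef_Qdag
      inner_add_right add_divide_distrib)

lemma Qdag_diff: "Qdag \<Theta> \<beta> p (X - Y) = Qdag \<Theta> \<beta> p X - Qdag \<Theta> \<beta> p Y"
  by (rule Sym_eq_iff) (simp_all add: Qdag_Sym subspace_diff[OF subspace_SymK] coef_Qdag
      inner_diff_right diff_divide_distrib)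

section \<open>Conjugation by the eigenvector matrix\<close>

lemma PP: "adjm P ** P = mat 1" "P ** adjm P = mat 1" and P_K: "entries_in_K rc P"
  using P matrix_left_right_inverse by (auto simp: unitaryK_def)

lemma invertible_P: "invertible P" "invertible (adjm P)"
  using PP by (auto simp: invertible_def)

lemma conj_P: "adjm P ** (P ** A ** adjm P) ** P = A" "P ** (adjm P ** A ** P) ** adjm P = A"
proof -
  have "adjm P ** (P ** A ** adjm P) ** P = (adjm P ** P) ** A ** (adjm P ** P)"
    by (simp only: matrix_mul_assoc)
  then show "adjm P ** (P ** A ** adjm P) ** P = A" by (simp add: PP)
  have "P ** (adjm P ** A ** P) ** adjm P = (P ** adjm P) ** A ** (P ** adjm P)"
    by (simp only: matrix_mul_assoc)
  then show "P ** (adjm P ** A ** P) ** adjm P = A" by (simp add: PP)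
qed

lemma conj_P_mult: "(P ** A ** adjm P) ** (P ** B ** adjm P) = P ** (A ** B) ** adjm P"
proof -
  have "(P ** A ** adjm P) ** (P ** B ** adjm P) = P ** A ** (adjm P ** P) ** B ** adjm P"
    by (simp only: matrix_mul_assoc)
  then show ?thesis by (simp add: PP matrix_mul_assoc)
qed

lemma lam_nonneg: "0 \<le> lam $ i"
proof -
  have "adjm P ** Xbar ** P = diagm lam" by (simp add: eig conj_P)
  then have "psdC (diagm lam :: ((complex, 'n) vec, 'n) vec)" using psdC_congruence[OF Xbar_psdC, of P] by simp
  then have "0 \<le> axis i 1 \<bullet> (diagm lam *v axis i (1 :: complex))" by (simp add: psdC_def)
  then show ?thesis
    by (simp add: inner_axis' diagm_mult_vec)
qed

text \<open>The eigenvalues are nonnegative and nonincreasing, and \<open>r\<close> of them are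
  nonzero, so these fill the first \<open>r\<close> indices. From here on blocks are described by
  eigenvalues instead of positions.\<close>

lemma in_block_iff: "in_block r i \<longleftrightarrow> lam $ i = 0"
proof -
  let ?N = "{i. lam $ i \<noteq> 0}"
  have r: "r = card ?N"
    using rank_Xbar by (simp add: eig rank_invertible_mult invertible_P rank_diagm)
  have down: "j \<in> ?N" if "i \<in> ?N" "j \<le> i" for i j
  proof -
    have "lam $ i \<le> lam $ j" using lam that by (simp add: nonincr_def)
    then show ?thesis using lam_nonneg[of i] that by auto
  qed
  show ?thesis
  proof
    assume "in_block r i"
    show "lam $ i = 0"
    proof (rule ccontr)
      assume "lam $ i \<noteq> 0"
      then have "{j. j < i} \<subset> ?N" using down[of i] by (auto simp: less_imp_le)
      then have "card {j. j < i} < r" unfolding r by (intro psubset_card_mono) auto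
      then show False using \<open>in_block r i\<close> by (simp add: in_block_def)
    qed
  next
    assume "lam $ i = 0"
    then have "?N \<subseteq> {j. j < i}" using down[of _ i] by (auto simp: not_less[symmetric])
    then show "in_block r i" unfolding r in_block_def by (intro card_mono) auto
  qed
qed

lemma L_zero: "lam $ i \<noteq> 0 \<or> lam $ j \<noteq> 0 \<Longrightarrow> L $ i $ j = 0" and L_Sym: "L \<in> SymK rc"
  using L(1) by (auto simp: block_sym_def in_block_iff)

lemma block_pos:
  assumes "v \<noteq> 0" "\<And>i. lam $ i \<noteq> 0 \<Longrightarrow> v $ i = 0" shows "0 < v \<bullet> (L *v v)"
  by (rule inner_pos_if_pos_on_K[OF L_Sym, where I = "{i. lam $ i \<noteq> 0}"])
    (use L(3) assms in \<open>auto simp: block_pd_def in_block_iff\<close>)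

section \<open>The multiplier \<open>S\<close> and strict complementarity\<close>

definition S where "S = P ** L ** adjm P"

lemma S_Sym: "S \<in> SymK rc"
  using SymK_congruence[OF L_Sym entries_in_K_closed(2)[OF P_K]] by (simp add: S_def)

lemma L_mult_vec_zero: "lam $ i \<noteq> 0 \<Longrightarrow> (L *v v) $ i = 0"
  by (simp add: matrix_vector_mult_def L_zero)

text \<open>\<open>L\<close> vanishes outside the trailing block, so cutting \<open>u\<close> down
  to that block leaves its form unchanged, and there \<open>L\<close> is positive definite.\<close>

lemma S_psdC: "psdC S"
proof -
  have "0 \<le> u \<bullet> (L *v u)" for u
  proof -
    define v where "v = (\<chi> i. if lam $ i = 0 then u $ i else 0)"
    have "L *v u = L *v v"
      by (auto simp: vec_eq_iff matrix_vector_mult_def v_def L_zero intro!: sum.cong)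
    moreover have "u \<bullet> (L *v u) = v \<bullet> (L *v u)"
      by (auto simp: inner_vec_def v_def L_mult_vec_zero intro!: sum.cong)
    moreover have "0 \<le> v \<bullet> (L *v v)"
      using block_pos[of v] by (cases "v = 0") (auto simp: v_def)
    ultimately show ?thesis by simp
  qed
  then have "psdC L" using L_Sym by (simp add: psdC_def SymK_def)
  then show ?thesis using psdC_congruence[of L "adjm P"] by (simp add: S_def)
qed

lemma S_Xbar: "S ** Xbar = 0"
proof -
  have "(L ** diagm lam) $ i $ j = 0" for i j
    by (cases "lam $ j = 0") (simp_all add: mult_diagm L_zero)
  then have "L ** diagm lam = 0" by (simp add: vec_eq_iff)
  then show ?thesis by (simp add: S_def eig conj_P_mult)
qed

lemma S_tangent: "S \<bullet> (Xbar ** W + adjm W ** Xbar) = 0"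
  using S_Sym Xbar_Sym by (subst inner_tangent) (auto simp: SymK_def S_Xbar)

text \<open>The orthogonal projector onto the range of \<open>Xbar\<close>, which is the kernel of
  \<open>S\<close>.\<close>

definition range_proj where "range_proj = P ** diagm (\<chi> i. if lam $ i = 0 then 0 else 1) ** adjm P"

lemma rank_range_proj: "rank range_proj \<le> r"
proof -
  \<comment> \<open>Where \<open>lam $ i = 0\<close> the quotient is multiplied by 0, so the value
    of \<open>1 / 0\<close> is harmless. The right factor \<open>Xbar\<close> then caps the rank at
    \<open>r\<close>.\<close>
  have "diagm (\<chi> i. if lam $ i = 0 then 0 else 1) = diagm (\<chi> i. 1 / lam $ i) ** diagm lam"
    unfolding vec_eq_iff diagm_mult by (simp add: diagm_def)
  then have "range_proj = (P ** diagm (\<chi> i. 1 / lam $ i) ** adjm P) ** Xbar"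
    by (simp add: range_proj_def eig conj_P_mult)
  then show ?thesis using rank_mult_le_right rank_Xbar by metis
qed

text \<open>Strict complementarity: a kernel vector of \<open>L + ?D\<close> has no leading
  coordinates, because the image of \<open>L\<close> has none, and on the trailing block
  \<open>L\<close> is positive definite.\<close>

lemma invertible_S_range_proj: "invertible (S + range_proj)"
proof -
  let ?D = "diagm (\<chi> i. if lam $ i = 0 then 0 else 1) :: ((complex, 'n) vec, 'n) vec"
  have D: "(?D *v v) $ i = (if lam $ i = 0 then 0 else v $ i)" for v i
    by (simp add: diagm_mult_vec)
  have "v = 0" if v: "(L + ?D) *v v = 0" for v
  proof (rule ccontr)
    assume "v \<noteq> 0"
    have *: "(L *v v) $ i + (?D *v v) $ i = 0" for i
      using v by (simp add: vec_eq_iff matrix_vector_mult_add_rdistrib)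
    have sup: "v $ i = 0" if "lam $ i \<noteq> 0" for i
      using *[of i] that by (simp add: D L_mult_vec_zero)
    then have "?D *v v = 0" by (auto simp: vec_eq_iff D)
    then have "L *v v = 0" using v by (simp add: matrix_vector_mult_add_rdistrib)
    then show False using block_pos[OF \<open>v \<noteq> 0\<close> sup] by simp
  qed
  then have "\<exists>B. B ** (L + ?D) = mat 1"
    unfolding matrix_left_invertible_ker by blast
  then have "invertible (L + ?D)" by (simp add: invertible_left_inverse)
  moreover have "S + range_proj = P ** (L + ?D) ** adjm P"
    by (simp add: S_def range_proj_def matrix_mult.add_left matrix_mult.add_right)
  ultimately show ?thesis by (simp add: invertible_mult invertible_P)
qed

text \<open>The minimizer of the limiting quadratic program in the variable \<open>(X - Xbar) / \<rho>\<close>, with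
  multiplier \<open>S\<close>.  The linear system says that \<open>P2\<^sup>T Dhat P2 = 0\<close>, i.e. that \<open>Dhat\<close> is tangent
  at \<open>Xbar\<close> to the matrices of rank \<open>r\<close>.\<close>
definition Dhat where "Dhat = Qdag \<Theta> \<beta> p (S - (mat 1 - FX))"

lemma Dhat_Sym: "Dhat \<in> SymK rc"
  by (simp add: Dhat_def Qdag_Sym)

lemma coef_Dhat: "k < d \<Longrightarrow> \<Theta> k \<bullet> Dhat = (if k \<in> \<beta> then (\<Theta> k \<bullet> S - \<Theta> k \<bullet> (mat 1 - FX)) / p k else 0)"
  by (simp add: Dhat_def coef_Qdag inner_diff_right)

lemma Dhat_tangent: "\<exists>W. entries_in_K rc W \<and> Dhat = Xbar ** W + adjm W ** Xbar"
proof -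
  define B where "B = adjm P ** Dhat ** P"
  have B_Sym: "B \<in> SymK rc" unfolding B_def by (rule SymK_congruence[OF Dhat_Sym P_K])
  have B_herm: "cnj (B $ i $ j) = B $ j $ i" for i j
    using B_Sym by (simp add: SymK_def adjm_def vec_eq_iff)
  have "Dhat = Qdag \<Theta> \<beta> p S - Qdag \<Theta> \<beta> p (mat 1 - FX)"
    by (simp add: Dhat_def Qdag_diff)
  then have "B = adjm P ** Qdag \<Theta> \<beta> p S ** P - adjm P ** Qdag \<Theta> \<beta> p (mat 1 - FX) ** P"
    by (simp add: B_def matrix_mult.diff_left matrix_mult.diff_right)
  then have B0: "B $ i $ j = 0" if "lam $ i = 0" "lam $ j = 0" for i j
    using L(2) that by (simp add: lin_system_def S_def in_block_iff)
  \<comment> \<open>Solves \<open>diagm lam ** V + adjm V ** diagm lam = B\<close> blockwise: in the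
    leading block each product gives half of \<open>B\<close>, in a mixed block one product gives
    all of it, and the trailing block is zero by \<open>B0\<close>.\<close>
  define V :: "((complex, 'n) vec, 'n) vec" where
    "V = (\<chi> i j. if lam $ i = 0 then 0
      else complex_of_real (1 / lam $ i) * (if lam $ j = 0 then 1 else complex_of_real (1 / 2)) * B $ i $ j)"
  have V_K: "entries_in_K rc V"
    using B_Sym Kset_closed(4)[of 0 rc] Kset_closed(4)[of 1 rc]
    by (auto simp: V_def entries_in_K_def SymK_def intro!: Kset_closed(2) Kset_closed(4) simp del: of_real_divide)
  have *: "diagm lam ** V + adjm V ** diagm lam = B"
    using B0 B_herm by (auto simp: vec_eq_iff diagm_mult mult_diagm adjm_def V_def)
  have adjW: "adjm (P ** V ** adjm P) = P ** adjm V ** adjm P"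
    by (simp add: adjm_mult matrix_mul_assoc)
  have "Xbar ** (P ** V ** adjm P) + adjm (P ** V ** adjm P) ** Xbar
      = P ** (diagm lam ** V + adjm V ** diagm lam) ** adjm P"
    unfolding adjW eig conj_P_mult by (simp add: matrix_mult.add_left matrix_mult.add_right)
  also have "\<dots> = Dhat" unfolding * B_def by (rule conj_P)
  finally show ?thesis
    using V_K P_K by (metis entries_in_K_mult entries_in_K_closed(2))
qed

text \<open>Such an \<open>a\<close> equals \<open>P B P\<^sup>*\<close> with \<open>B\<close> in the trailing block, and \<open>Qdag\<close> kills it, so
  \<open>L + B\<close> solves the linear system as well.\<close>
lemma alpha_nondegenerate:
  assumes a: "a \<in> SymK rc" "\<And>k. k \<in> \<beta> \<Longrightarrow> \<Theta> k \<bullet> a = 0" "a ** Xbar = 0"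
  shows "a = 0"
proof -
  define B where "B = adjm P ** a ** P"
  have a_eq: "a = P ** B ** adjm P" unfolding B_def by (simp add: conj_P)
  have B_Sym: "B \<in> SymK rc" unfolding B_def by (rule SymK_congruence[OF a(1) P_K])
  have B_herm: "cnj (B $ i $ j) = B $ j $ i" for i j
    using B_Sym by (simp add: SymK_def adjm_def vec_eq_iff)
  have "P ** (B ** diagm lam) ** adjm P = 0"
    using a(3) by (simp add: a_eq eig conj_P_mult)
  then have "B ** diagm lam = 0"
    using conj_P(1)[of "B ** diagm lam"] by simp
  then have B0: "B $ i $ j = 0" if "lam $ j \<noteq> 0" for i j
    using that by (simp add: vec_eq_iff mult_diagm) blast
  have B0': "B $ i $ j = 0" if "lam $ i \<noteq> 0" for i j
    using B0[OF that, of j] B_herm[of j i] by simp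
  have "block_sym rc r (L + B)"
    unfolding block_sym_def in_block_iff using L_zero B0 B0' subspace_add[OF subspace_SymK L_Sym B_Sym]
    by auto
  moreover have "Qdag \<Theta> \<beta> p (P ** (L + B) ** adjm P) = Qdag \<Theta> \<beta> p (P ** L ** adjm P)"
  proof -
    have "Qdag \<Theta> \<beta> p a = 0"
      using a(2) by (simp add: Qdag_def ipS_eq_inner)
    then show ?thesis
      by (simp add: matrix_mult.add_left matrix_mult.add_right Qdag_add a_eq[symmetric])
  qed
  ultimately have "L + B = L" using L(2) by (intro L_unique) (simp_all add: lin_system_def)
  then show ?thesis by (simp add: a_eq)
qed

end

context psd_completion
begin

section \<open>Optimality conditions\<close>

text \<open>Finite-dimensional duality: within \<open>SymK rc\<close>, the orthogonal complement of
  those tangent directions that have no \<alpha> coordinates is the sum of \<open>V\<close>, the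
  complement of \<open>T\<close>, and \<open>A\<close>. The proof projects \<open>h\<close> onto
  this sum and shows that the remainder \<open>z\<close> vanishes.\<close>

lemma tangent_decomposition:
  assumes X: "X \<in> SymK rc" and h: "h \<in> SymK rc"
    and ann: "\<And>W. entries_in_K rc W \<Longrightarrow> (\<forall>k\<in>\<alpha>. \<Theta> k \<bullet> (X ** W + adjm W ** X) = 0)
        \<Longrightarrow> h \<bullet> (X ** W + adjm W ** X) = 0"
  shows "\<exists>a. a \<in> span (\<Theta> ` \<alpha>) \<and> (h - a) ** X = 0"
proof -
  define T where "T = (\<lambda>W. X ** W + adjm W ** X) ` {W. entries_in_K rc W}"
  define V where "V = {Z \<in> SymK rc. Z ** X = 0}"
  define A where "A = span (\<Theta> ` \<alpha>)"
  have A_Sym: "A \<subseteq> SymK rc"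
    unfolding A_def using alpha basis_in by (intro span_minimal subspace_SymK) auto
  have lin: "linear (\<lambda>W. X ** W + adjm W ** X)"
    by (rule linearI) (simp_all add: matrix_mult.add_left matrix_mult.add_right
        matrix_mult.scaleR_left matrix_mult.scaleR_right scaleR_right_distrib)
  have "subspace {W :: ((complex, 'n) vec, 'n) vec. entries_in_K rc W}"
    by (auto simp: subspace_def intro: entries_in_K_closed)
      (simp add: entries_in_K_def Kset_closed(4)[of 0, simplified])
  then have T: "subspace T" unfolding T_def by (rule linear_subspace_image[OF lin])
  have T_Sym: "T \<subseteq> SymK rc" using X by (auto simp: T_def intro: SymK_tangent)
  have V: "subspace V"
    unfolding V_def subspace_def using subspace_SymK[of rc]
    by (auto simp: subspace_def matrix_mult.add_left matrix_mult.scaleR_left)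
  define VA where "VA = {z + a | z a. z \<in> V \<and> a \<in> A}"
  have VA: "subspace VA" unfolding VA_def A_def by (rule subspace_sums[OF V subspace_span])
  have V_VA: "V \<subseteq> VA"
    unfolding VA_def A_def using span_zero[of "\<Theta> ` \<alpha>"] by force
  have A_VA: "A \<subseteq> VA"
    unfolding VA_def using subspace_0[OF V] by force
  have VA_Sym: "VA \<subseteq> SymK rc"
    using A_Sym by (auto simp: VA_def V_def intro: subspace_add[OF subspace_SymK])
  obtain y z where yz: "y \<in> VA" "\<And>w. w \<in> VA \<Longrightarrow> orthogonal z w" "h = y + z"
    using orthogonal_subspace_decomp_exists[of VA h] span_eq_iff[THEN iffD2, OF VA] by metis
  obtain t s where ts: "t \<in> T" "\<And>w. w \<in> T \<Longrightarrow> orthogonal s w" "z = t + s"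
    using orthogonal_subspace_decomp_exists[of T z] span_eq_iff[THEN iffD2, OF T] by metis
  have z_Sym: "z \<in> SymK rc"
    using subspace_diff[OF subspace_SymK h, of y] yz VA_Sym by auto
  have s_Sym: "s \<in> SymK rc"
    using subspace_diff[OF subspace_SymK z_Sym, of t] ts T_Sym by auto
  have "s ** X = 0"
  proof -
    let ?W = "adjm (s ** X)"
    have "entries_in_K rc ?W"
      using s_Sym X by (auto simp: SymK_def intro!: entries_in_K_closed entries_in_K_mult)
    then have "X ** ?W + adjm ?W ** X \<in> T" unfolding T_def by blast
    then have "s \<bullet> (X ** ?W + adjm ?W ** X) = 0"
      using ts(2) unfolding orthogonal_def by blast
    then have "?W \<bullet> ?W = 0"
      using inner_tangent[of s X ?W] s_Sym X by (simp add: SymK_def)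
    then have "?W = 0" by simp
    then show ?thesis using adjm_simps(1)[of "s ** X"] by simp
  qed
  \<comment> \<open>\<open>z = t + s\<close> is orthogonal to \<open>VA\<close>, hence to
    \<open>s\<close>, and \<open>s\<close> is orthogonal to \<open>t\<close>; so
    \<open>s = 0\<close>. Thus \<open>z\<close> is a tangent direction without \<alpha> coordinates,
    on which \<open>h\<close> vanishes.\<close>
  then have "s \<in> VA" using s_Sym V_VA by (auto simp: V_def)
  then have "s \<bullet> s = 0"
    using yz(2)[of s] ts(2)[OF ts(1)] inner_commute[of t s]
    by (simp add: ts(3) orthogonal_def inner_add_left)
  then have "z \<in> T" using ts by simp
  then obtain W where W: "entries_in_K rc W" "z = X ** W + adjm W ** X" by (auto simp: T_def)
  have "\<Theta> k \<bullet> z = 0" if "k \<in> \<alpha>" for k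
    using yz(2)[of "\<Theta> k"] A_VA that
    by (simp add: subset_iff A_def span_base orthogonal_def inner_commute)
  then have "h \<bullet> z = 0" using ann[OF W(1)] W(2) by simp
  moreover have "y \<bullet> z = 0" using yz(2)[OF yz(1)] by (simp add: orthogonal_def inner_commute)
  ultimately have "z = 0" by (simp add: yz(3) inner_add_left)
  then obtain v a where "v \<in> V" "a \<in> A" "h = v + a" using yz by (auto simp: VA_def)
  then show ?thesis by (intro exI[of _ a]) (auto simp: V_def A_def)
qed

lemma span_alpha:
  assumes "a \<in> span (\<Theta> ` \<alpha>)"
  shows "a \<in> SymK rc" "k \<in> \<beta> \<Longrightarrow> \<Theta> k \<bullet> a = 0"
proof -
  show "a \<in> SymK rc"
    using span_minimal[of "\<Theta> ` \<alpha>" "SymK rc"] assms alpha basis_in subspace_SymK by auto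
  assume "k \<in> \<beta>"
  then have "orthogonal (\<Theta> k) a"
    using alpha by (intro orthogonal_to_span[OF assms]) (auto simp: orthogonal_def beta basis_orth)
  then show "\<Theta> k \<bullet> a = 0" by (simp add: orthogonal_def)
qed

text \<open>The matrix \<open>Z = S + e - a\<close> with \<open>Z X = 0\<close> is a dual certificate of \<open>X\<close>; nondegeneracy of the
  constraints \<open>\<alpha>\<close> at \<open>Xbar\<close> forces \<open>a\<close> to be small, hence \<open>Z\<close> has at least the rank of \<open>S\<close>.\<close>
lemma rank_le_of_near_dual:
  "\<exists>\<eta>>0. \<forall>X e. X \<in> SymK rc \<longrightarrow> norm (X - Xbar) < \<eta> \<longrightarrow> e \<in> SymK rc \<longrightarrow> norm e < \<eta> \<longrightarrow>
     (\<forall>W. entries_in_K rc W \<longrightarrow> (\<forall>k\<in>\<alpha>. \<Theta> k \<bullet> (X ** W + adjm W ** X) = 0)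
        \<longrightarrow> (S + e) \<bullet> (X ** W + adjm W ** X) = 0) \<longrightarrow> rank X \<le> r"
proof -
  obtain K where K: "K > 0" "\<And>(A :: ((complex, 'n) vec, 'n) vec) (B :: ((complex, 'n) vec, 'n) vec). norm (A ** B) \<le> norm A * norm B * K"
    using matrix_mult.pos_bounded by blast
  \<comment> \<open>Nondegeneracy makes this map injective on the span of the \<alpha> basis
    matrices, hence bounded below there by some \<open>c\<close>.\<close>
  have "bounded_linear (\<lambda>a. a ** Xbar)" by (rule matrix_mult.bounded_linear_left)
  then obtain c where c: "c > 0" "\<And>a. a \<in> span (\<Theta> ` \<alpha>) \<Longrightarrow> c * norm a \<le> norm (a ** Xbar)"
    using injective_imp_isometric[of "span (\<Theta> ` \<alpha>)" "\<lambda>a. a ** Xbar"]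
    by (metis alpha_nondegenerate closed_subspace span_alpha subspace_span)
  obtain e1 where e1: "e1 > 0" "\<And>B. norm (B - (S + range_proj)) < e1 \<Longrightarrow> invertible B"
    using invertible_nearby[OF invertible_S_range_proj] by blast
  \<comment> \<open>\<open>c |a| \<le> |a X| + K \<eta> |a|\<close> and
    \<open>K \<eta> \<le> c / 2\<close> give \<open>|a| \<le> C \<eta>\<close>; the two summands
    bound \<open>S ** (X - Xbar)\<close> and \<open>e ** X\<close>.\<close>
  define C where "C = 2 / c * (K * norm S + K * (norm Xbar + 1))"
  have C: "C \<ge> 0" using c K by (simp add: C_def)
  define \<eta> where "\<eta> = min 1 (min (c / (2 * K)) (e1 / (1 + C)))"
  have \<eta>: "\<eta> > 0" "\<eta> \<le> 1" "K * \<eta> \<le> c / 2" "(1 + C) * \<eta> \<le> e1"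
  proof -
    show "\<eta> > 0" "\<eta> \<le> 1" using c K e1 C by (auto simp: \<eta>_def)
    have "\<eta> \<le> c / (2 * K)" "\<eta> \<le> e1 / (1 + C)" by (auto simp: \<eta>_def)
    then show "K * \<eta> \<le> c / 2" "(1 + C) * \<eta> \<le> e1" using K C by (auto simp: field_simps)
  qed
  show ?thesis
  proof (intro exI[of _ \<eta>] conjI allI impI)
    show "\<eta> > 0" by (rule \<eta>)
    fix X e
    assume X: "X \<in> SymK rc" "norm (X - Xbar) < \<eta>" and e: "e \<in> SymK rc" "norm e < \<eta>"
      and ann: "\<forall>W. entries_in_K rc W \<longrightarrow> (\<forall>k\<in>\<alpha>. \<Theta> k \<bullet> (X ** W + adjm W ** X) = 0)
        \<longrightarrow> (S + e) \<bullet> (X ** W + adjm W ** X) = 0"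
    obtain a where a: "a \<in> span (\<Theta> ` \<alpha>)" "(S + e - a) ** X = 0"
      using tangent_decomposition[OF X(1) subspace_add[OF subspace_SymK S_Sym e(1)]] ann by blast
    have nX: "norm X \<le> norm Xbar + 1"
      using norm_triangle_ineq[of Xbar "X - Xbar"] X(2) \<eta>(2) by simp
    have aX: "a ** X = S ** (X - Xbar) + e ** X"
      using a(2) by (simp add: matrix_mult.diff_left matrix_mult.add_left matrix_mult.diff_right S_Xbar)
    have "norm (a ** X) \<le> norm (S ** (X - Xbar)) + norm (e ** X)"
      unfolding aX by (rule norm_triangle_ineq)
    also have "\<dots> \<le> norm S * norm (X - Xbar) * K + norm e * norm X * K"
      by (rule add_mono[OF K(2) K(2)])
    also have "\<dots> \<le> norm S * \<eta> * K + \<eta> * (norm Xbar + 1) * K"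
      using X(2) e(2) nX K(1) \<eta>(1) by (intro add_mono mult_mono mult_nonneg_nonneg) auto
    finally have 1: "norm (a ** X) \<le> (K * norm S + K * (norm Xbar + 1)) * \<eta>"
      by (simp add: algebra_simps)
    have "c * norm a \<le> norm (a ** Xbar)" by (rule c(2)[OF a(1)])
    also have "a ** Xbar = a ** X - a ** (X - Xbar)" by (simp add: matrix_mult.diff_right)
    also have "norm \<dots> \<le> norm (a ** X) + norm (a ** (X - Xbar))" by (rule norm_triangle_ineq4)
    also have "norm (a ** (X - Xbar)) \<le> norm a * norm (X - Xbar) * K" by (rule K(2))
    also have "\<dots> \<le> norm a * \<eta> * K"
      using X(2) K(1) by (intro mult_right_mono mult_left_mono) auto
    also have "\<dots> \<le> norm a * (c / 2)"
      using mult_left_mono[OF \<eta>(3) norm_ge_zero[of a]] by (simp add: mult_ac)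
    finally have "norm a * (c / 2) \<le> norm (a ** X)" by (simp add: algebra_simps)
    with 1 have "norm a * (c / 2) \<le> (K * norm S + K * (norm Xbar + 1)) * \<eta>" by linarith
    then have na: "norm a \<le> C * \<eta>" using c(1) by (simp add: C_def field_simps)
    define Z where "Z = S + e - a"
    have "norm (Z - S) \<le> norm e + norm a" using norm_triangle_ineq4[of e a] by (simp add: Z_def)
    also have "\<dots> < \<eta> + C * \<eta>" using e(2) na by linarith
    also have "\<dots> \<le> e1" using \<eta>(4) by (simp add: algebra_simps)
    finally have inv: "invertible (Z + range_proj)" by (intro e1(2)) simp
    \<comment> \<open>Because \<open>Z ** X = 0\<close>, the invertible matrix
      \<open>Z + range_proj\<close> acts on \<open>X\<close> as \<open>range_proj\<close>
      alone.\<close>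
    have "rank X = rank ((Z + range_proj) ** X)" by (rule rank_invertible_mult(1)[OF inv, symmetric])
    also have "(Z + range_proj) ** X = range_proj ** X"
      using a(2) by (simp add: Z_def matrix_mult.add_left)
    also have "rank \<dots> \<le> r" using rank_mult_le_left rank_range_proj le_trans by blast
    finally show "rank X \<le> r" .
  qed
qed

section \<open>Feasible curves and first-order stationarity\<close>

definition feasible where
  "feasible X \<longleftrightarrow> psdK rc X \<and> (\<forall>k\<in>\<alpha>. \<Theta> k \<bullet> X = \<Theta> k \<bullet> Xbar)"

lemma feasible_convex:
  assumes "feasible X" "feasible Y" "0 \<le> t" "t \<le> 1"
  shows "feasible (X + t *\<^sub>R (Y - X))"
proof -
  have eq: "X + t *\<^sub>R (Y - X) = (1 - t) *\<^sub>R X + t *\<^sub>R Y" by (simp add: algebra_simps)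
  show ?thesis
    unfolding eq using assms
    by (auto simp: feasible_def psdK_iff inner_add_right intro!: psdC_add psdC_scaleR
        subspace_add[OF subspace_SymK] subspace_scale[OF subspace_SymK])
      (simp add: algebra_simps)
qed

lemma feasible_Xbar: "feasible Xbar"
  by (simp add: feasible_def Xbar_psd)

text \<open>The curve mixes \<open>X + t Y\<close> with \<open>X0\<close> in weight
  \<open>\<kappa> t^2\<close>; both have the prescribed \<alpha> coordinates. In this form its
  deviation from \<open>X + t Y\<close> is visibly of order \<open>t^2\<close>.\<close>

lemma feasible_perturb_tangent:
  assumes X: "feasible X" and W: "entries_in_K rc W"
    and Y: "Y = X ** W + adjm W ** X" "\<forall>k\<in>\<alpha>. \<Theta> k \<bullet> Y = 0"
  shows "\<exists>\<kappa>\<ge>0. \<forall>t. \<kappa> * t\<^sup>2 \<le> 1 \<longrightarrow> feasible (X + t *\<^sub>R Y + (\<kappa> * t\<^sup>2) *\<^sub>R (X0 - X - t *\<^sub>R Y))"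
proof -
  have X': "X \<in> SymK rc" "psdC X" using X by (auto simp: feasible_def psdK_iff)
  have Sym: "Y \<in> SymK rc" "X0 \<in> SymK rc"
    using SymK_tangent[OF X'(1) W] X0(1) by (auto simp: Y pdK_def)
  obtain \<kappa> where \<kappa>: "\<kappa> \<ge> 0" "\<And>t. \<kappa> * t\<^sup>2 \<le> 1 \<Longrightarrow>
      psdC ((1 - \<kappa> * t\<^sup>2) *\<^sub>R (X + t *\<^sub>R Y) + (\<kappa> * t\<^sup>2) *\<^sub>R X0)"
    using psdC_perturb_tangent[OF X'(2) X0(1), of W] Y(1) by blast
  have eq: "X + t *\<^sub>R Y + (\<kappa> * t\<^sup>2) *\<^sub>R (X0 - X - t *\<^sub>R Y)
      = (1 - \<kappa> * t\<^sup>2) *\<^sub>R (X + t *\<^sub>R Y) + (\<kappa> * t\<^sup>2) *\<^sub>R X0" for t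
    by (simp add: algebra_simps)
  have "X + t *\<^sub>R Y + (\<kappa> * t\<^sup>2) *\<^sub>R (X0 - X - t *\<^sub>R Y) \<in> SymK rc" for t
    using X'(1) Sym by (intro subspace_add[OF subspace_SymK] subspace_diff[OF subspace_SymK]
        subspace_scale[OF subspace_SymK])
  moreover have "\<Theta> k \<bullet> (X + t *\<^sub>R Y + (\<kappa> * t\<^sup>2) *\<^sub>R (X0 - X - t *\<^sub>R Y)) = \<Theta> k \<bullet> Xbar" if "k \<in> \<alpha>" for k t
    using that X Y(2) X0(2) by (simp add: feasible_def inner_add_right inner_diff_right)
  ultimately show ?thesis
    using \<kappa> by (intro exI[of _ \<kappa>]) (simp add: feasible_def psdK_iff eq)
qed

text \<open>Replacing \<open>W\<close> by \<open>- W\<close> reverses the tangent direction, so the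
  variational inequality along feasible curves bounds both signs.\<close>

lemma tangent_annihilation:
  assumes X: "feasible X" and VI: "\<And>Y. feasible Y \<Longrightarrow> 0 \<le> h \<bullet> (Y - X)"
    and W: "entries_in_K rc W" and Y: "\<forall>k\<in>\<alpha>. \<Theta> k \<bullet> (X ** W + adjm W ** X) = 0"
  shows "h \<bullet> (X ** W + adjm W ** X) = 0"
proof -
  have nonneg: "0 \<le> h \<bullet> (X ** W + adjm W ** X)"
    if W: "entries_in_K rc W" and Y: "\<forall>k\<in>\<alpha>. \<Theta> k \<bullet> (X ** W + adjm W ** X) = 0" for W
  proof (rule ccontr)
    define Z where "Z = X ** W + adjm W ** X"
    assume "\<not> 0 \<le> h \<bullet> (X ** W + adjm W ** X)"
    then have neg: "h \<bullet> Z < 0" by (simp add: Z_def)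
    obtain \<kappa> where \<kappa>: "\<kappa> \<ge> 0" "\<And>t. \<kappa> * t\<^sup>2 \<le> 1 \<Longrightarrow>
        feasible (X + t *\<^sub>R Z + (\<kappa> * t\<^sup>2) *\<^sub>R (X0 - X - t *\<^sub>R Z))"
      using feasible_perturb_tangent[OF X W Z_def] Y by (auto simp: Z_def)
    \<comment> \<open>The range of \<open>t\<close> keeps \<open>\<kappa> t^2\<close> below 1/2. As
      \<open>h \<bullet> Z\<close> is negative, the factor \<open>1 - \<kappa> t^2\<close> may be
      replaced by 1/2, which leaves a quadratic in \<open>t\<close>.\<close>
    have "0 \<le> (h \<bullet> Z) / 2"
    proof (rule linear_coeff_nonneg[of "min 1 (1 / (2 * (\<kappa> + 1)))" _ "\<kappa> * (h \<bullet> (X0 - X))"])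
      show "0 < min 1 (1 / (2 * (\<kappa> + 1)))" using \<kappa>(1) by simp
      fix t :: real
      assume t: "0 < t" "t \<le> min 1 (1 / (2 * (\<kappa> + 1)))"
      have "t * t \<le> t * 1" using t by (intro mult_left_mono) auto
      then have "\<kappa> * t\<^sup>2 \<le> \<kappa> * t" using \<kappa>(1) by (intro mult_left_mono) (auto simp: power2_eq_square)
      also have "\<dots> \<le> \<kappa> * (1 / (2 * (\<kappa> + 1)))" using t \<kappa>(1) by (intro mult_left_mono) auto
      also have "\<dots> \<le> 1 / 2" using \<kappa>(1) by (simp add: field_simps)
      finally have half: "\<kappa> * t\<^sup>2 \<le> 1 / 2" .
      then have "0 \<le> h \<bullet> (t *\<^sub>R Z + (\<kappa> * t\<^sup>2) *\<^sub>R (X0 - X - t *\<^sub>R Z))"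
        using VI[OF \<kappa>(2), of t] by (simp add: algebra_simps)
      also have "\<dots> = (1 - \<kappa> * t\<^sup>2) * (t * (h \<bullet> Z)) + t\<^sup>2 * (\<kappa> * (h \<bullet> (X0 - X)))"
        by (simp add: inner_add_right inner_diff_right algebra_simps)
      also have "(1 - \<kappa> * t\<^sup>2) * (t * (h \<bullet> Z)) \<le> (1 / 2) * (t * (h \<bullet> Z))"
        using half neg t by (intro mult_right_mono_neg) (auto simp: mult_pos_neg less_imp_le)
      finally show "0 \<le> t * (h \<bullet> Z / 2) + t\<^sup>2 * (\<kappa> * (h \<bullet> (X0 - X)))" by simp
    qed
    then show False using neg by simp
  qed
  have minus: "X ** (- W) + adjm (- W) ** X = - (X ** W + adjm W ** X)"
  proof -
    have "adjm (- W) = - adjm W" by (simp add: adjm_def vec_eq_iff)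
    then show ?thesis by (simp add: matrix_mult.minus_left matrix_mult.minus_right)
  qed
  have "entries_in_K rc (- W)" using entries_in_K_closed(3)[OF W, of "-1"] by simp
  then have "0 \<le> h \<bullet> (X ** (- W) + adjm (- W) ** X)"
    using Y unfolding minus by (intro nonneg[of "- W", unfolded minus]) (auto simp only: inner_minus_right minus_zero)
  then show ?thesis using nonneg[OF W Y] unfolding minus inner_minus_right by linarith
qed

text \<open>The variational inequality is tested at a feasible point \<open>Xbar + \<rho> Dhat + O(\<rho>\<^sup>2)\<close>, and
  \<open>S \<bullet> X \<ge> 0 = S \<bullet> Xbar = S \<bullet> Dhat\<close> removes the first-order terms; what remains is
  \<open>pm x\<^sup>2 \<le> \<epsilon> C (1 + x)\<^sup>2\<close> for the error norm \<open>x\<close>.\<close>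
lemma solution_expansion_error:
  assumes \<eta>: "\<eta> > 0"
  shows "\<exists>\<epsilon>>0. \<forall>\<rho> X h. 0 < \<rho> \<longrightarrow> \<rho> \<le> \<epsilon> \<longrightarrow> feasible X \<longrightarrow> (\<forall>Y. feasible Y \<longrightarrow> 0 \<le> h \<bullet> (Y - X)) \<longrightarrow>
     (\<forall>k\<in>\<alpha>. \<Theta> k \<bullet> h = \<Theta> k \<bullet> S) \<longrightarrow>
     (\<forall>k\<in>\<beta>. \<bar>\<Theta> k \<bullet> h - \<Theta> k \<bullet> S - p k * (\<Theta> k \<bullet> ((X - Xbar) /\<^sub>R \<rho> - Dhat))\<bar>
        \<le> \<epsilon> * (1 + norm ((X - Xbar) /\<^sub>R \<rho> - Dhat))) \<longrightarrow>
     norm ((X - Xbar) /\<^sub>R \<rho> - Dhat) < \<eta>"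
proof -
  obtain W where W: "entries_in_K rc W" "Dhat = Xbar ** W + adjm W ** Xbar" using Dhat_tangent by blast
  have "\<forall>k\<in>\<alpha>. \<Theta> k \<bullet> Dhat = 0"
  proof
    fix k assume "k \<in> \<alpha>"
    then have "k < d" "k \<notin> \<beta>" using alpha by (auto simp: beta)
    then show "\<Theta> k \<bullet> Dhat = 0" by (simp add: coef_Dhat)
  qed
  then obtain \<kappa> where \<kappa>: "\<kappa> \<ge> 0" "\<And>t. \<kappa> * t\<^sup>2 \<le> 1 \<Longrightarrow>
      feasible (Xbar + t *\<^sub>R Dhat + (\<kappa> * t\<^sup>2) *\<^sub>R (X0 - Xbar - t *\<^sub>R Dhat))"
    using feasible_perturb_tangent[OF feasible_Xbar W] by blast
  \<comment> \<open>Bounds the second-order remainder \<open>R\<close> of the test curve for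
    \<open>\<rho> \<le> 1\<close>.\<close>
  define CR where "CR = \<kappa> * (norm X0 + norm Xbar + norm Dhat)"
  define b where "b = real (card \<beta>)"
  have "\<beta> \<noteq> {}" using p_sum by auto
  define pm where "pm = Min (p ` \<beta>)"
  have pm: "pm > 0" "\<And>k. k \<in> \<beta> \<Longrightarrow> pm \<le> p k"
    using \<open>\<beta> \<noteq> {}\<close> p_pos by (auto simp: pm_def)

  have CR: "CR \<ge> 0" using \<kappa> by (simp add: CR_def)
  \<comment> \<open>The summands come from \<open>S \<bullet> D\<close>, from the products of
    \<open>\<delta>\<close> with \<open>\<rho> R\<close>, and from the errors \<open>e k\<close>,
    each compared with \<open>(1 + x)^2\<close>.\<close>
  define C where "C = norm S * CR + b * CR + b * (1 + CR)"
  have C: "C \<ge> 0" using CR by (simp add: C_def b_def)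
  \<comment> \<open>In order, the bounds give \<open>\<rho>^2 \<le> \<epsilon>\<close>, feasibility
    of the test point, absorption of the error's \<open>x^2\<close> term into half of
    \<open>pm x^2\<close>, and a remainder below \<open>pm \<eta>^2\<close>.\<close>
  define \<epsilon> where "\<epsilon> = min 1 (min (1 / (\<kappa> + 1)) (min (pm / (4 * (C + 1))) (pm * \<eta>\<^sup>2 / (8 * (C + 1)))))"
  have \<epsilon>: "\<epsilon> > 0" "\<epsilon> \<le> 1" "\<kappa> * \<epsilon> \<le> 1" "2 * \<epsilon> * C \<le> pm / 2" "4 * \<epsilon> * C < pm * \<eta>\<^sup>2"
  proof -
    show pos: "\<epsilon> > 0" and "\<epsilon> \<le> 1" using \<kappa> pm C \<eta> by (auto simp: \<epsilon>_def)
    have a: "\<epsilon> \<le> 1 / (\<kappa> + 1)" "\<epsilon> \<le> pm / (4 * (C + 1))" "\<epsilon> \<le> pm * \<eta>\<^sup>2 / (8 * (C + 1))"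
      by (auto simp: \<epsilon>_def)
    then show "\<kappa> * \<epsilon> \<le> 1" "2 * \<epsilon> * C \<le> pm / 2"
      using \<kappa> C pos by (auto simp: field_simps)
    have "8 * (\<epsilon> * (C + 1)) \<le> pm * \<eta>\<^sup>2" using a(3) C by (simp add: field_simps)
    moreover have "0 \<le> \<epsilon> * C" using pos C by simp
    ultimately show "4 * \<epsilon> * C < pm * \<eta>\<^sup>2" using pos by (simp add: algebra_simps)
  qed
  show ?thesis
  proof (intro exI[of _ \<epsilon>] conjI allI impI)
    show "\<epsilon> > 0" by (rule \<epsilon>)
    fix \<rho> X h
    define \<delta> where "\<delta> = (X - Xbar) /\<^sub>R \<rho> - Dhat"
    define x where "x = norm \<delta>"
    assume \<rho>: "0 < \<rho>" "\<rho> \<le> \<epsilon>" and X: "feasible X"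
      and VI: "\<forall>Y. feasible Y \<longrightarrow> 0 \<le> h \<bullet> (Y - X)"
      and h\<alpha>: "\<forall>k\<in>\<alpha>. \<Theta> k \<bullet> h = \<Theta> k \<bullet> S"
      and h\<beta>: "\<forall>k\<in>\<beta>. \<bar>\<Theta> k \<bullet> h - \<Theta> k \<bullet> S - p k * (\<Theta> k \<bullet> ((X - Xbar) /\<^sub>R \<rho> - Dhat))\<bar>
        \<le> \<epsilon> * (1 + norm ((X - Xbar) /\<^sub>R \<rho> - Dhat))"
    have X_Sym: "X \<in> SymK rc" and X_psd: "psdC X" using X by (auto simp: feasible_def psdK_iff)
    define e where "e k = \<Theta> k \<bullet> h - \<Theta> k \<bullet> S - p k * (\<Theta> k \<bullet> \<delta>)" for k
    have e: "\<bar>e k\<bar> \<le> \<epsilon> * (1 + x)" if "k \<in> \<beta>" for k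
      using h\<beta> that by (simp add: e_def \<delta>_def x_def)
    have x0: "x \<ge> 0" by (simp add: x_def)
    have \<delta>_Sym: "\<delta> \<in> SymK rc"
      unfolding \<delta>_def using X_Sym Xbar_Sym Dhat_Sym
      by (intro subspace_diff[OF subspace_SymK] subspace_scale[OF subspace_SymK])
    have \<delta>\<alpha>: "\<Theta> k \<bullet> \<delta> = 0" if "k \<in> \<alpha>" for k
      using that X \<open>\<forall>k\<in>\<alpha>. \<Theta> k \<bullet> Dhat = 0\<close> by (simp add: \<delta>_def feasible_def inner_diff_right)
    define R where "R = \<kappa> *\<^sub>R (X0 - Xbar - \<rho> *\<^sub>R Dhat)"
    have "\<rho>\<^sup>2 \<le> \<epsilon>" using \<rho> \<epsilon>(2) by (simp add: power2_eq_square) (metis dual_order.trans less_imp_le mult_left_le)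
    then have "\<kappa> * \<rho>\<^sup>2 \<le> 1" using \<epsilon>(3) \<kappa>(1) by (meson mult_left_mono order_trans)
    from \<kappa>(2)[OF this] have feas: "feasible (Xbar + \<rho> *\<^sub>R Dhat + \<rho>\<^sup>2 *\<^sub>R R)"
      by (simp add: R_def mult.commute)
    have norm_R: "norm R \<le> CR"
    proof -
      have "norm (X0 - Xbar - \<rho> *\<^sub>R Dhat) \<le> norm X0 + norm Xbar + norm (\<rho> *\<^sub>R Dhat)"
        by (meson add_mono norm_triangle_ineq4 order_refl order_trans)
      also have "norm (\<rho> *\<^sub>R Dhat) \<le> norm Dhat"
        using \<rho> \<epsilon>(2) by (simp add: mult_left_le_one_le)
      finally show ?thesis using \<kappa>(1) by (simp add: R_def CR_def mult_left_mono)
    qed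
    have R_Sym: "R \<in> SymK rc"
      unfolding R_def using X0(1) Xbar_Sym Dhat_Sym
      by (intro subspace_diff[OF subspace_SymK] subspace_scale[OF subspace_SymK]) (auto simp: pdK_def)
    have R\<alpha>: "\<Theta> k \<bullet> R = 0" if "k \<in> \<alpha>" for k
      using that X0(2) \<open>\<forall>k\<in>\<alpha>. \<Theta> k \<bullet> Dhat = 0\<close> by (simp add: R_def inner_diff_right)
    define D where "D = \<rho> *\<^sub>R R - \<delta>"
    have D_eq: "Xbar + \<rho> *\<^sub>R Dhat + \<rho>\<^sup>2 *\<^sub>R R - X = \<rho> *\<^sub>R D"
      using \<rho>(1) by (simp add: D_def \<delta>_def algebra_simps power2_eq_square)
    have D_Sym: "D \<in> SymK rc" unfolding D_def
      using R_Sym \<delta>_Sym by (intro subspace_diff[OF subspace_SymK] subspace_scale[OF subspace_SymK])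
    have "0 \<le> h \<bullet> (\<rho> *\<^sub>R D)" using VI feas D_eq by metis
    then have "0 \<le> h \<bullet> D" using \<rho>(1) by (simp add: zero_le_mult_iff)
    also have "h \<bullet> D = S \<bullet> D + (h - S) \<bullet> D" by (simp add: inner_diff_left)
    also have "(h - S) \<bullet> D = (\<Sum>k\<in>\<beta>. (p k * (\<Theta> k \<bullet> \<delta>) + e k) * (\<Theta> k \<bullet> D))"
      by (subst inner_beta[OF D_Sym]) (simp_all add: D_def R\<alpha> \<delta>\<alpha> e_def inner_diff_right)
    also have "S \<bullet> D \<le> \<epsilon> * (norm S * CR)"
    proof -
      have "\<rho> * (S \<bullet> D) = \<rho>\<^sup>2 * (S \<bullet> R) - S \<bullet> X"
      proof -
        have "S \<bullet> Xbar = 0"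
          using S_Sym S_Xbar by (simp add: inner_eq_trace SymK_def trace_def)
        moreover have "S \<bullet> Dhat = 0" using S_tangent W(2) by simp
        ultimately have "S \<bullet> (\<rho> *\<^sub>R D) = \<rho>\<^sup>2 * (S \<bullet> R) - S \<bullet> X"
          by (simp add: D_eq[symmetric] inner_diff_right inner_add_right)
        then show ?thesis by simp
      qed
      also have "\<dots> \<le> \<rho>\<^sup>2 * (S \<bullet> R)" using psdC_inner_nonneg[OF S_psdC X_psd] by simp
      finally have "\<rho> * (S \<bullet> D) \<le> \<rho> * (\<rho> * (S \<bullet> R))" by (simp add: power2_eq_square mult.assoc)
      then have "S \<bullet> D \<le> \<rho> * (S \<bullet> R)" using \<rho>(1) by simp
      also have "\<dots> \<le> \<rho> * (norm S * norm R)" using \<rho>(1) by (intro mult_left_mono norm_cauchy_schwarz) auto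
      also have "\<dots> \<le> \<epsilon> * (norm S * CR)" using \<rho> norm_R CR by (intro mult_mono mult_left_mono) auto
      finally show ?thesis .
    qed
    \<comment> \<open>The curvature supplies \<open>- pm (\<Theta> k \<bullet> \<delta>)^2\<close>;
      everything else carries a factor \<epsilon>, the product with \<open>R\<close> through
      \<open>\<rho> \<le> \<epsilon>\<close> and \<open>e k\<close> by assumption.\<close>
    also have "(\<Sum>k\<in>\<beta>. (p k * (\<Theta> k \<bullet> \<delta>) + e k) * (\<Theta> k \<bullet> D))
        \<le> (\<Sum>k\<in>\<beta>. - pm * (\<Theta> k \<bullet> \<delta>)\<^sup>2 + \<epsilon> * (CR * x + (1 + x) * (x + CR)))"
    proof (rule sum_mono)
      fix k assume k: "k \<in> \<beta>"
      let ?\<delta> = "\<Theta> k \<bullet> \<delta>" and ?R = "\<rho> * (\<Theta> k \<bullet> R)"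
      have \<delta>k: "\<bar>?\<delta>\<bar> \<le> x" unfolding x_def using k by (intro coef_le_norm beta_less)
      have Rk: "\<bar>?R\<bar> \<le> \<epsilon> * CR"
        using \<rho> coef_le_norm[OF beta_less[OF k], of R] norm_R by (simp add: abs_mult mult_mono)
      have Rk': "\<bar>?R\<bar> \<le> CR" using Rk CR \<epsilon>(2) by (meson mult_left_le_one_le order_trans \<epsilon>(1) less_imp_le)
      have "p k * ?\<delta> * ?R \<le> \<bar>p k * ?\<delta>\<bar> * \<bar>?R\<bar>" by (metis abs_ge_self abs_mult)
      also have "\<dots> \<le> x * (\<epsilon> * CR)"
      proof (intro mult_mono Rk x0 abs_ge_zero)
        have "\<bar>p k * ?\<delta>\<bar> \<le> 1 * x"
          unfolding abs_mult using \<delta>k p_le_1[OF k] p_pos[OF k] by (intro mult_mono) auto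
        then show "\<bar>p k * ?\<delta>\<bar> \<le> x" by simp
      qed
      finally have 1: "p k * ?\<delta> * ?R \<le> x * (\<epsilon> * CR)" .
      have "e k * (?R - ?\<delta>) \<le> \<bar>e k\<bar> * \<bar>?R - ?\<delta>\<bar>" by (metis abs_ge_self abs_mult)
      also have "\<dots> \<le> \<epsilon> * (1 + x) * (x + CR)"
        using e[OF k] Rk' \<delta>k x0 \<epsilon>(1) by (intro mult_mono) auto
      finally have 2: "e k * (?R - ?\<delta>) \<le> \<epsilon> * (1 + x) * (x + CR)" .
      have 3: "pm * ?\<delta>\<^sup>2 \<le> p k * ?\<delta>\<^sup>2" using pm(2)[OF k] by (intro mult_right_mono) auto
      have "(p k * ?\<delta> + e k) * (\<Theta> k \<bullet> D) = - (p k * ?\<delta>\<^sup>2) + p k * ?\<delta> * ?R + e k * (?R - ?\<delta>)"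
        by (simp add: D_def inner_diff_right algebra_simps power2_eq_square)
      then show "(p k * ?\<delta> + e k) * (\<Theta> k \<bullet> D) \<le> - pm * ?\<delta>\<^sup>2 + \<epsilon> * (CR * x + (1 + x) * (x + CR))"
        using 1 2 3 by (simp add: algebra_simps)
    qed
    also have "\<dots> = - pm * x\<^sup>2 + \<epsilon> * (b * (CR * x + (1 + x) * (x + CR)))"
    proof -
      have "x\<^sup>2 = (\<Sum>k\<in>\<beta>. (\<Theta> k \<bullet> \<delta>)\<^sup>2)"
        unfolding x_def power2_norm_eq_inner by (subst inner_beta[OF \<delta>_Sym \<delta>\<alpha>]) (auto simp: power2_eq_square)
      then show ?thesis
        by (simp add: sum.distrib sum_subtractf sum_negf flip: sum_distrib_left) (simp add: b_def)
    qed
    finally have "pm * x\<^sup>2 \<le> \<epsilon> * (norm S * CR + b * (CR * x + (1 + x) * (x + CR)))"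
      by (simp add: algebra_simps)
    also have "\<dots> \<le> \<epsilon> * (C * (1 + x)\<^sup>2)"
    proof -
      have sq: "1 \<le> (1 + x)\<^sup>2" "x \<le> (1 + x)\<^sup>2"
        using x0 by (auto simp: power2_eq_square algebra_simps)
      have "norm S * CR * 1 \<le> norm S * CR * (1 + x)\<^sup>2" using CR sq by (intro mult_left_mono) auto
      moreover have "b * CR * x \<le> b * CR * (1 + x)\<^sup>2" using CR sq by (intro mult_left_mono) (auto simp: b_def)
      moreover have "b * ((1 + x) * (x + CR)) \<le> b * ((1 + x) * ((1 + CR) * (1 + x)))"
        using CR x0 by (intro mult_left_mono) (auto simp: b_def algebra_simps)
      ultimately have "norm S * CR + b * (CR * x + (1 + x) * (x + CR)) \<le> C * (1 + x)\<^sup>2"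
        by (simp add: C_def power2_eq_square algebra_simps)
      then show ?thesis using \<epsilon>(1) by (intro mult_left_mono) auto
    qed
    also have "\<dots> \<le> \<epsilon> * (C * (2 * (1 + x\<^sup>2)))"
    proof -
      have "(1 + x)\<^sup>2 \<le> 2 * (1 + x\<^sup>2)"
        using sum_squares_ge_zero[of "x - 1" 0] by (simp add: power2_eq_square algebra_simps)
      then show ?thesis using C \<epsilon>(1) by (intro mult_left_mono) auto
    qed
    also have "\<dots> = 2 * \<epsilon> * C + 2 * \<epsilon> * C * x\<^sup>2" by (simp add: algebra_simps)
    also have "\<dots> \<le> 2 * \<epsilon> * C + pm / 2 * x\<^sup>2" using \<epsilon>(4) by (intro add_left_mono mult_right_mono) auto
    finally have "pm * x\<^sup>2 \<le> 4 * \<epsilon> * C" by simp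
    also have "\<dots> < pm * \<eta>\<^sup>2" by (rule \<epsilon>(5))
    finally have "x\<^sup>2 < \<eta>\<^sup>2" using pm(1) by simp
    then show "norm ((X - Xbar) /\<^sub>R \<rho> - Dhat) < \<eta>"
      using \<eta> by (simp add: x_def[unfolded \<delta>_def, symmetric] power_less_imp_less_base less_imp_le)
  qed
qed

end

section \<open>The estimator\<close>

text \<open>Together with \<open>noise\<close> this captures the sample: when all labels lie in
  \<beta>, the loss depends on it, up to an additive constant, only through these averages per
  label.\<close>

definition freq :: "(nat \<Rightarrow> nat) \<Rightarrow> nat \<Rightarrow> nat \<Rightarrow> real" where
  "freq om m k = (\<Sum>i<m. of_bool (om i = k)) / real m"

definition noise :: "(nat \<Rightarrow> nat) \<Rightarrow> (nat \<Rightarrow> real) \<Rightarrow> nat \<Rightarrow> nat \<Rightarrow> real" where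
  "noise om z m k = (\<Sum>i<m. z i * of_bool (om i = k)) / real m"

context psd_completion
begin

lemma sum_group_by_label:
  assumes "\<And>i. i < m \<Longrightarrow> om i \<in> \<beta>"
  shows "(\<Sum>i<m. g i * c (om i)) = (\<Sum>k\<in>\<beta>. (\<Sum>i<m. g i * of_bool (om i = k)) * (c k :: real))"
proof -
  have "(\<Sum>i<m. g i * c (om i)) = (\<Sum>i<m. \<Sum>k\<in>\<beta>. g i * of_bool (om i = k) * c k)"
  proof (rule sum.cong)
    fix i assume "i \<in> {..<m}"
    then have "om i \<in> \<beta>" using assms by simp
    have "(\<Sum>k\<in>\<beta>. g i * of_bool (om i = k) * c k) = (\<Sum>k\<in>\<beta>. if om i = k then g i * c k else 0)"
      by (rule sum.cong) auto
    then show "g i * c (om i) = (\<Sum>k\<in>\<beta>. g i * of_bool (om i = k) * c k)"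
      using \<open>om i \<in> \<beta>\<close> by simp
  qed simp
  also have "\<dots> = (\<Sum>k\<in>\<beta>. \<Sum>i<m. g i * of_bool (om i = k) * c k)" by (rule sum.swap)
  finally show ?thesis by (simp add: sum_distrib_right)
qed

text \<open>The objective is quadratic, so the second-order expansion is exact. Collecting
  observations by label turns sums over the sample into sums over \<beta>.\<close>

lemma objective_expansion:
  fixes om :: "nat \<Rightarrow> nat" and z :: "nat \<Rightarrow> real" and \<rho> \<gamma> :: real
    and F :: "((complex, 'n) vec, 'n) vec \<Rightarrow> ((complex, 'n) vec, 'n) vec" and X Xt :: "((complex, 'n) vec, 'n) vec"
  assumes m: "m > 0" and om: "\<And>i. i < m \<Longrightarrow> om i \<in> \<beta>"
  defines "J \<equiv> objective \<Theta> om (\<lambda>i. ipS (\<Theta> (om i)) Xbar + z i) m \<rho> \<gamma> F Xt"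
  shows "J (X + D) = J X
    + ((\<Sum>k\<in>\<beta>. (freq om m k * (\<Theta> k \<bullet> (X - Xbar)) - noise om z m k) * (\<Theta> k \<bullet> D))
      + \<rho> * ((mat 1 - F Xt) \<bullet> D + \<gamma> * ((X - Xt) \<bullet> D)))
    + ((\<Sum>k\<in>\<beta>. freq om m k * (\<Theta> k \<bullet> D)\<^sup>2) / 2 + \<rho> * \<gamma> / 2 * (norm D)\<^sup>2)"
proof -
  let ?x = "\<lambda>k. \<Theta> k \<bullet> (X - Xbar)" and ?d = "\<lambda>k. \<Theta> k \<bullet> D"
  have "(\<Sum>i<m. (z i - (?x (om i) + ?d (om i)))\<^sup>2) = (\<Sum>i<m. (z i - ?x (om i))\<^sup>2)
      + 2 * ((\<Sum>i<m. 1 * (?x (om i) * ?d (om i))) - (\<Sum>i<m. z i * ?d (om i))) + (\<Sum>i<m. 1 * (?d (om i))\<^sup>2)"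
    by (simp add: sum_distrib_left flip: sum.distrib sum_subtractf)
      (rule sum.cong, auto simp: power2_eq_square algebra_simps)
  also have "(\<Sum>i<m. 1 * (?x (om i) * ?d (om i))) = real m * (\<Sum>k\<in>\<beta>. freq om m k * (?x k * ?d k))"
    by (subst sum_group_by_label[OF om]) (use m in \<open>simp_all add: freq_def sum_distrib_left mult_ac\<close>)
  also have "(\<Sum>i<m. 1 * (?d (om i))\<^sup>2) = real m * (\<Sum>k\<in>\<beta>. freq om m k * (?d k)\<^sup>2)"
    by (subst sum_group_by_label[OF om, where c = "\<lambda>k. (?d k)\<^sup>2"])
      (use m in \<open>simp_all add: freq_def sum_distrib_left mult_ac\<close>)
  also have "(\<Sum>i<m. z i * ?d (om i)) = real m * (\<Sum>k\<in>\<beta>. noise om z m k * ?d k)"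
  proof -
    have "(\<Sum>i<m. z i * of_bool (om i = k)) = real m * noise om z m k" for k
      using m by (simp add: noise_def)
    then show ?thesis
      by (subst sum_group_by_label[OF om]) (simp_all only: sum_distrib_left mult.assoc)
  qed
  finally have 1: "1 / (2 * real m) * (\<Sum>i<m. (z i - (?x (om i) + ?d (om i)))\<^sup>2)
      = 1 / (2 * real m) * (\<Sum>i<m. (z i - ?x (om i))\<^sup>2)
        + ((\<Sum>k\<in>\<beta>. freq om m k * (?x k * ?d k)) - (\<Sum>k\<in>\<beta>. noise om z m k * ?d k))
        + (\<Sum>k\<in>\<beta>. freq om m k * (?d k)\<^sup>2) / 2"
    using m by (simp add: field_simps)
  have 2: "(norm (X + D - Xt))\<^sup>2 = (norm (X - Xt))\<^sup>2 + 2 * ((X - Xt) \<bullet> D) + (norm D)\<^sup>2"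
    by (simp add: power2_norm_eq_inner inner_add_left inner_add_right inner_diff_left inner_diff_right inner_commute)
  have 3: "(\<Sum>k\<in>\<beta>. (freq om m k * ?x k - noise om z m k) * ?d k)
      = (\<Sum>k\<in>\<beta>. freq om m k * (?x k * ?d k)) - (\<Sum>k\<in>\<beta>. noise om z m k * ?d k)"
    by (simp add: sum_subtractf left_diff_distrib mult.assoc)
  have res: "\<Theta> (om i) \<bullet> Xbar + z i - \<Theta> (om i) \<bullet> (X + D) = z i - (?x (om i) + ?d (om i))"
    "\<Theta> (om i) \<bullet> Xbar + z i - \<Theta> (om i) \<bullet> X = z i - ?x (om i)" for i
    by (simp_all add: inner_add_right inner_diff_right)
  show ?thesis
    unfolding J_def objective_def ipS_eq_inner res 1 2 3
    by (simp add: inner_add_right algebra_simps)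
qed

text \<open>The inequality is the derivative of the objective along the feasible segment from
  \<open>X\<close> to \<open>Y\<close>, divided by \<open>\<rho>\<close>. Leaving the \<alpha>
  coordinates of \<open>h\<close> free allows them to be matched with those of \<open>S\<close>
  later.\<close>

lemma optimal_variational_inequality:
  fixes om :: "nat \<Rightarrow> nat" and z :: "nat \<Rightarrow> real" and \<rho> \<gamma> :: real
    and F :: "((complex, 'n) vec, 'n) vec \<Rightarrow> ((complex, 'n) vec, 'n) vec" and X Xt :: "((complex, 'n) vec, 'n) vec"
  assumes m: "m > 0" and om: "\<And>i. i < m \<Longrightarrow> om i \<in> \<beta>" and \<rho>: "\<rho> > 0"
  defines "J \<equiv> objective \<Theta> om (\<lambda>i. ipS (\<Theta> (om i)) Xbar + z i) m \<rho> \<gamma> F Xt"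
  assumes X: "feasible X" and opt: "\<And>Y. feasible Y \<Longrightarrow> J X \<le> J Y"
    and h: "\<And>k. k \<in> \<beta> \<Longrightarrow> \<Theta> k \<bullet> h = (freq om m k * (\<Theta> k \<bullet> (X - Xbar)) - noise om z m k) / \<rho>
      + \<Theta> k \<bullet> (mat 1 - F Xt) + \<gamma> * (\<Theta> k \<bullet> (X - Xt))"
    and Y: "feasible Y"
  shows "0 \<le> h \<bullet> (Y - X)"
proof -
  define D where "D = Y - X"
  have D: "D \<in> SymK rc" "\<And>k. k \<in> \<alpha> \<Longrightarrow> \<Theta> k \<bullet> D = 0"
    using X Y subspace_diff[OF subspace_SymK, of Y rc X]
    by (auto simp: D_def feasible_def psdK_iff inner_diff_right)
  let ?G = "\<lambda>D. (\<Sum>k\<in>\<beta>. (freq om m k * (\<Theta> k \<bullet> (X - Xbar)) - noise om z m k) * (\<Theta> k \<bullet> D))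
      + \<rho> * ((mat 1 - F Xt) \<bullet> D + \<gamma> * ((X - Xt) \<bullet> D))"
  let ?Q = "\<lambda>D. (\<Sum>k\<in>\<beta>. freq om m k * (\<Theta> k \<bullet> D)\<^sup>2) / 2 + \<rho> * \<gamma> / 2 * (norm D)\<^sup>2"
  have "?G D = \<rho> * (h \<bullet> D)"
  proof -
    have *: "V \<bullet> D = (\<Sum>k\<in>\<beta>. (\<Theta> k \<bullet> V) * (\<Theta> k \<bullet> D))" for V
      by (rule inner_beta[OF D])
    have "\<rho> * (h \<bullet> D) = (\<Sum>k\<in>\<beta>. \<rho> * ((\<Theta> k \<bullet> h) * (\<Theta> k \<bullet> D)))"
      unfolding *[of h] by (rule sum_distrib_left)
    also have "\<dots> = (\<Sum>k\<in>\<beta>. (freq om m k * (\<Theta> k \<bullet> (X - Xbar)) - noise om z m k) * (\<Theta> k \<bullet> D)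
        + (\<rho> * ((\<Theta> k \<bullet> (mat 1 - F Xt)) * (\<Theta> k \<bullet> D)) + \<rho> * \<gamma> * ((\<Theta> k \<bullet> (X - Xt)) * (\<Theta> k \<bullet> D))))"
    proof (rule sum.cong)
      fix k assume "k \<in> \<beta>"
      then have "\<rho> * (\<Theta> k \<bullet> h) = (freq om m k * (\<Theta> k \<bullet> (X - Xbar)) - noise om z m k)
          + \<rho> * (\<Theta> k \<bullet> (mat 1 - F Xt)) + \<rho> * \<gamma> * (\<Theta> k \<bullet> (X - Xt))"
        using \<rho> by (simp only: h) (simp add: distrib_left)
      then have "\<rho> * (\<Theta> k \<bullet> h) * (\<Theta> k \<bullet> D) = ((freq om m k * (\<Theta> k \<bullet> (X - Xbar)) - noise om z m k)
          + \<rho> * (\<Theta> k \<bullet> (mat 1 - F Xt)) + \<rho> * \<gamma> * (\<Theta> k \<bullet> (X - Xt))) * (\<Theta> k \<bullet> D)" by simp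
      then show "\<rho> * ((\<Theta> k \<bullet> h) * (\<Theta> k \<bullet> D))
          = (freq om m k * (\<Theta> k \<bullet> (X - Xbar)) - noise om z m k) * (\<Theta> k \<bullet> D)
          + (\<rho> * ((\<Theta> k \<bullet> (mat 1 - F Xt)) * (\<Theta> k \<bullet> D)) + \<rho> * \<gamma> * ((\<Theta> k \<bullet> (X - Xt)) * (\<Theta> k \<bullet> D)))"
        by (simp only: mult.assoc distrib_right add.assoc)
    qed simp
    also have "\<dots> = ?G D"
      unfolding *[of "mat 1 - F Xt"] *[of "X - Xt"] sum.distrib sum_distrib_left[symmetric]
      by (simp add: distrib_left mult.assoc)
    finally show ?thesis by simp
  qed
  moreover have "0 \<le> ?G D"
  proof (rule linear_coeff_nonneg[of 1 _ "?Q D"])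
    fix t :: real assume t: "0 < t" "t \<le> 1"
    have "J X \<le> J (X + t *\<^sub>R D)"
      unfolding D_def using t by (intro opt feasible_convex X Y) auto
    also have "\<dots> = J X + ?G (t *\<^sub>R D) + ?Q (t *\<^sub>R D)"
      unfolding J_def by (rule objective_expansion[OF m om])
    also have "?G (t *\<^sub>R D) = t * ?G D"
      by (simp add: distrib_left sum_distrib_left mult_ac)
    also have "?Q (t *\<^sub>R D) = t\<^sup>2 * ?Q D"
      by (simp add: distrib_left sum_distrib_left mult_ac power_mult_distrib)
    finally show "0 \<le> t * ?G D + t\<^sup>2 * ?Q D" by simp
  qed simp
  ultimately show ?thesis using \<rho> by (simp add: D_def zero_le_mult_iff)
qed

text \<open>The deterministic core, with one \<epsilon> for all samples and sample sizes. The two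
  smallness conditions on \<open>\<gamma>\<close> control the gradient of the proximal term, since
  \<open>X - Xt\<close> splits into \<open>\<rho> (Dhat + \<delta>)\<close> and
  \<open>Xbar - Xt\<close>.\<close>

theorem rank_eq_of_small_perturbation:
  "\<exists>\<epsilon>>0. \<forall>m om z \<rho> \<gamma> F Xt X. m > 0 \<longrightarrow> (\<forall>i<m. om i \<in> \<beta>) \<longrightarrow> 0 < \<rho> \<longrightarrow> \<rho> \<le> \<epsilon> \<longrightarrow> 0 \<le> \<gamma> \<longrightarrow>
     (\<forall>k\<in>\<beta>. \<bar>noise om z m k\<bar> \<le> \<epsilon> * \<rho> \<and> \<bar>freq om m k - p k\<bar> \<le> \<epsilon>) \<longrightarrow>
     norm (F Xt - FX) \<le> \<epsilon> \<longrightarrow> \<gamma> * \<rho> \<le> \<epsilon> \<longrightarrow> \<gamma> * norm (Xt - Xbar) \<le> \<epsilon> \<longrightarrow> feasible X \<longrightarrow>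
     (\<forall>Y. feasible Y \<longrightarrow> objective \<Theta> om (\<lambda>i. ipS (\<Theta> (om i)) Xbar + z i) m \<rho> \<gamma> F Xt X
        \<le> objective \<Theta> om (\<lambda>i. ipS (\<Theta> (om i)) Xbar + z i) m \<rho> \<gamma> F Xt Y) \<longrightarrow> rank X = r"
proof -
  obtain \<eta>1 where \<eta>1: "\<eta>1 > 0" "\<And>X e. X \<in> SymK rc \<Longrightarrow> norm (X - Xbar) < \<eta>1 \<Longrightarrow> e \<in> SymK rc \<Longrightarrow> norm e < \<eta>1 \<Longrightarrow>
     (\<And>W. entries_in_K rc W \<Longrightarrow> (\<forall>k\<in>\<alpha>. \<Theta> k \<bullet> (X ** W + adjm W ** X) = 0)
        \<Longrightarrow> (S + e) \<bullet> (X ** W + adjm W ** X) = 0) \<Longrightarrow> rank X \<le> r"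
    using rank_le_of_near_dual by metis
  obtain \<eta>2 where \<eta>2: "\<eta>2 > 0" "\<And>X. norm (X - Xbar) < \<eta>2 \<Longrightarrow> r \<le> rank X"
    using rank_lower_semicontinuous[of Xbar] rank_Xbar by blast
  define b c where "b = real (card \<beta>)" and "c = norm Dhat"
  have bc: "b \<ge> 0" "c \<ge> 0" by (auto simp: b_def c_def)
  \<comment> \<open>Each of the \<open>b\<close> coordinates of \<open>e\<close> will be at most
    \<open>\<eta> + 2 \<epsilon>2\<close>; allotting \<open>\<eta>1 / (4 (b + 1))\<close> to either
    part keeps the sum below \<open>\<eta>1\<close>.\<close>
  define \<eta> where "\<eta> = min 1 (\<eta>1 / (4 * (b + 1)))"
  have \<eta>: "\<eta> > 0" "\<eta> \<le> 1" "\<eta> \<le> \<eta>1 / (4 * (b + 1))" using \<eta>1(1) bc by (auto simp: \<eta>_def)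
  obtain \<epsilon>1 where \<epsilon>1: "\<epsilon>1 > 0" "\<And>\<rho> X h. 0 < \<rho> \<Longrightarrow> \<rho> \<le> \<epsilon>1 \<Longrightarrow> feasible X \<Longrightarrow>
     (\<And>Y. feasible Y \<Longrightarrow> 0 \<le> h \<bullet> (Y - X)) \<Longrightarrow> (\<And>k. k \<in> \<alpha> \<Longrightarrow> \<Theta> k \<bullet> h = \<Theta> k \<bullet> S) \<Longrightarrow>
     (\<And>k. k \<in> \<beta> \<Longrightarrow> \<bar>\<Theta> k \<bullet> h - \<Theta> k \<bullet> S - p k * (\<Theta> k \<bullet> ((X - Xbar) /\<^sub>R \<rho> - Dhat))\<bar>
        \<le> \<epsilon>1 * (1 + norm ((X - Xbar) /\<^sub>R \<rho> - Dhat))) \<Longrightarrow>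
     norm ((X - Xbar) /\<^sub>R \<rho> - Dhat) < \<eta>"
    using solution_expansion_error[OF \<eta>(1)] by metis
  define \<epsilon>2 where "\<epsilon>2 = min \<epsilon>1 (min (\<eta>1 / (8 * (b + 1))) (min (\<eta>1 / 2) (\<eta>2 / 2)))"
  have \<epsilon>2: "\<epsilon>2 > 0" "\<epsilon>2 \<le> \<epsilon>1" "\<epsilon>2 \<le> \<eta>1 / (8 * (b + 1))" "\<epsilon>2 < \<eta>1" "\<epsilon>2 < \<eta>2"
    using \<epsilon>1(1) \<eta>1(1) \<eta>2(1) bc by (auto simp: \<epsilon>2_def min_less_iff_disj)
  \<comment> \<open>\<open>err\<close> meets three errors of size \<epsilon> and two of size
    \<open>\<epsilon> (|\<delta>| + c)\<close>, together at most
    \<open>\<epsilon> (3 + 2 c) (1 + |\<delta>|)\<close>.\<close>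
  define \<epsilon> where "\<epsilon> = \<epsilon>2 / (3 + 2 * c)"
  have \<epsilon>: "\<epsilon> > 0" "\<epsilon> * (3 + 2 * c) = \<epsilon>2" using \<epsilon>2(1) bc by (auto simp: \<epsilon>_def)
  have \<epsilon>c: "\<epsilon> \<le> \<epsilon>2" "\<epsilon> * (c + 1) \<le> \<epsilon>2"
    using \<epsilon>(1) bc mult_nonneg_nonneg[of \<epsilon> c] unfolding \<epsilon>(2)[symmetric]
    by (auto simp: distrib_left)
  show ?thesis
  proof (intro exI[of _ \<epsilon>] conjI allI impI)
    show "\<epsilon> > 0" by (rule \<epsilon>)
    fix m om z \<rho> \<gamma> X Xt and F :: "((complex, 'n) vec, 'n) vec \<Rightarrow> ((complex, 'n) vec, 'n) vec"
    assume m: "m > 0" and om: "\<forall>i<m. om i \<in> \<beta>" and \<rho>: "0 < \<rho>" "\<rho> \<le> \<epsilon>" and \<gamma>: "0 \<le> \<gamma>"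
      and stat: "\<forall>k\<in>\<beta>. \<bar>noise om z m k\<bar> \<le> \<epsilon> * \<rho> \<and> \<bar>freq om m k - p k\<bar> \<le> \<epsilon>"
      and Fe: "norm (F Xt - FX) \<le> \<epsilon>" and \<gamma>\<rho>: "\<gamma> * \<rho> \<le> \<epsilon>" and \<gamma>X: "\<gamma> * norm (Xt - Xbar) \<le> \<epsilon>"
      and X: "feasible X"
      and opt: "\<forall>Y. feasible Y \<longrightarrow> objective \<Theta> om (\<lambda>i. ipS (\<Theta> (om i)) Xbar + z i) m \<rho> \<gamma> F Xt X
        \<le> objective \<Theta> om (\<lambda>i. ipS (\<Theta> (om i)) Xbar + z i) m \<rho> \<gamma> F Xt Y"
    have X_Sym: "X \<in> SymK rc" using X by (simp add: feasible_def psdK_iff)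
    define \<delta> where "\<delta> = (X - Xbar) /\<^sub>R \<rho> - Dhat"
    define g where "g k = (freq om m k * (\<Theta> k \<bullet> (X - Xbar)) - noise om z m k) / \<rho>
      + \<Theta> k \<bullet> (mat 1 - F Xt) + \<gamma> * (\<Theta> k \<bullet> (X - Xt))" for k
    \<comment> \<open>Chosen so that \<open>S + e\<close> has the rescaled gradient \<open>g\<close>
      as its \<beta> coordinates and agrees with \<open>S\<close> in the \<alpha>
      coordinates.\<close>
    define e where "e = (\<Sum>k\<in>\<beta>. (g k - \<Theta> k \<bullet> S) *\<^sub>R \<Theta> k)"
    have e_Sym: "e \<in> SymK rc"
      unfolding e_def by (intro subspace_sum[OF subspace_SymK] subspace_scale[OF subspace_SymK] basis_in beta_less)
    have h: "\<Theta> k \<bullet> (S + e) = (if k \<in> \<beta> then g k else \<Theta> k \<bullet> S)" if "k < d" for k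
      using that by (simp add: inner_add_right e_def coef_sum_beta)
    have VI: "0 \<le> (S + e) \<bullet> (Y - X)" if "feasible Y" for Y
    proof (rule optimal_variational_inequality[OF m _ \<rho>(1) X _ _ that])
      show "om i \<in> \<beta>" if "i < m" for i using om that by simp
      show "objective \<Theta> om (\<lambda>i. ipS (\<Theta> (om i)) Xbar + z i) m \<rho> \<gamma> F Xt X
        \<le> objective \<Theta> om (\<lambda>i. ipS (\<Theta> (om i)) Xbar + z i) m \<rho> \<gamma> F Xt Y" if "feasible Y" for Y
        using opt that by simp
      show "\<Theta> k \<bullet> (S + e) = (freq om m k * (\<Theta> k \<bullet> (X - Xbar)) - noise om z m k) / \<rho>
          + \<Theta> k \<bullet> (mat 1 - F Xt) + \<gamma> * (\<Theta> k \<bullet> (X - Xt))" if "k \<in> \<beta>" for k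
        using h[OF beta_less[OF that]] that by (simp add: g_def)
    qed
    have err: "\<bar>g k - \<Theta> k \<bullet> S - p k * (\<Theta> k \<bullet> \<delta>)\<bar> \<le> \<epsilon>2 * (1 + norm \<delta>)" if k: "k \<in> \<beta>" for k
    proof -
      let ?D = "\<Theta> k \<bullet> \<delta> + \<Theta> k \<bullet> Dhat"
      have kd: "k < d" using k by (rule beta_less)
      have X_eq: "\<Theta> k \<bullet> (X - Xbar) = \<rho> * ?D"
        using \<rho>(1) by (simp add: \<delta>_def inner_diff_right)
      have S_eq: "\<Theta> k \<bullet> S = \<Theta> k \<bullet> (mat 1 - FX) + p k * (\<Theta> k \<bullet> Dhat)"
        using k p_pos[OF k] by (simp add: coef_Dhat[OF kd])
      have Xt_eq: "\<Theta> k \<bullet> (X - Xt) = \<rho> * ?D - \<Theta> k \<bullet> (Xt - Xbar)"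
        using X_eq by (simp add: inner_diff_right)
      have F_eq: "\<Theta> k \<bullet> (mat 1 - F Xt) = \<Theta> k \<bullet> (mat 1 - FX) - \<Theta> k \<bullet> (F Xt - FX)"
        by (simp add: inner_diff_right)
      \<comment> \<open>By \<open>S_eq\<close> the limiting gradient at \<open>Dhat\<close> agrees
        with \<open>S\<close> in coordinate \<open>k\<close>, so the main terms cancel and five
        perturbations remain.\<close>
      have "g k - \<Theta> k \<bullet> S - p k * (\<Theta> k \<bullet> \<delta>) = - (noise om z m k / \<rho>) + (freq om m k - p k) * ?D
          - \<Theta> k \<bullet> (F Xt - FX) + (\<gamma> * \<rho>) * ?D - \<gamma> * (\<Theta> k \<bullet> (Xt - Xbar))"
        unfolding g_def S_eq X_eq Xt_eq F_eq using \<rho>(1) by (simp add: field_simps)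
      also have "\<bar>\<dots>\<bar> \<le> \<bar>noise om z m k / \<rho>\<bar> + \<bar>(freq om m k - p k) * ?D\<bar>
          + \<bar>\<Theta> k \<bullet> (F Xt - FX)\<bar> + \<bar>(\<gamma> * \<rho>) * ?D\<bar> + \<bar>\<gamma> * (\<Theta> k \<bullet> (Xt - Xbar))\<bar>" by linarith
      also have "\<dots> \<le> \<epsilon> + \<epsilon> * (norm \<delta> + c) + \<epsilon> + \<epsilon> * (norm \<delta> + c) + \<epsilon>"
      proof (intro add_mono)
        have D: "\<bar>?D\<bar> \<le> norm \<delta> + c"
          using coef_le_norm[OF kd, of \<delta>] coef_le_norm[OF kd, of Dhat] by (simp add: c_def)
        show "\<bar>noise om z m k / \<rho>\<bar> \<le> \<epsilon>" using stat k \<rho>(1) by (simp add: abs_divide field_simps)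
        show "\<bar>(freq om m k - p k) * ?D\<bar> \<le> \<epsilon> * (norm \<delta> + c)"
          unfolding abs_mult using stat k D \<epsilon>(1) by (intro mult_mono) auto
        show "\<bar>\<Theta> k \<bullet> (F Xt - FX)\<bar> \<le> \<epsilon>" using coef_le_norm[OF kd] Fe by (rule order_trans)
        show "\<bar>(\<gamma> * \<rho>) * ?D\<bar> \<le> \<epsilon> * (norm \<delta> + c)"
          unfolding abs_mult[of "\<gamma> * \<rho>"] using \<gamma> \<rho>(1) \<gamma>\<rho> D \<epsilon>(1) by (intro mult_mono) auto
        have "\<gamma> * \<bar>\<Theta> k \<bullet> (Xt - Xbar)\<bar> \<le> \<gamma> * norm (Xt - Xbar)"
          using \<gamma> by (intro mult_left_mono coef_le_norm kd)
        then show "\<bar>\<gamma> * (\<Theta> k \<bullet> (Xt - Xbar))\<bar> \<le> \<epsilon>" using \<gamma>X \<gamma> by (simp add: abs_mult)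
      qed
      also have "\<dots> \<le> \<epsilon> * (3 + 2 * c) * (1 + norm \<delta>)"
        using \<epsilon>(1) bc by (simp add: algebra_simps)
      finally show ?thesis unfolding \<epsilon>(2) .
    qed
    have \<delta>_small: "norm \<delta> < \<eta>"
      unfolding \<delta>_def
    proof (rule \<epsilon>1(2)[where h = "S + e", OF \<rho>(1) _ X VI])
      show "\<rho> \<le> \<epsilon>1" using \<rho>(2) \<epsilon>c(1) \<epsilon>2(2) by linarith
      show "\<Theta> k \<bullet> (S + e) = \<Theta> k \<bullet> S" if "k \<in> \<alpha>" for k
        using h[of k] alpha that by (auto simp: beta)
      fix k assume k: "k \<in> \<beta>"
      have "\<epsilon>2 * (1 + norm \<delta>) \<le> \<epsilon>1 * (1 + norm \<delta>)" using \<epsilon>2(2) by (intro mult_right_mono) auto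
      then show "\<bar>\<Theta> k \<bullet> (S + e) - \<Theta> k \<bullet> S - p k * (\<Theta> k \<bullet> ((X - Xbar) /\<^sub>R \<rho> - Dhat))\<bar>
          \<le> \<epsilon>1 * (1 + norm ((X - Xbar) /\<^sub>R \<rho> - Dhat))"
        using err[OF k] h[OF beta_less[OF k]] k by (simp add: \<delta>_def[symmetric])
    qed
    have "norm e < \<eta>1"
    proof -
      have "norm e \<le> (\<Sum>k\<in>\<beta>. norm ((g k - \<Theta> k \<bullet> S) *\<^sub>R \<Theta> k))" unfolding e_def by (rule norm_sum)
      also have "\<dots> \<le> (\<Sum>k\<in>\<beta>. \<eta>1 / (2 * (b + 1)))"
      proof (rule sum_mono)
        fix k assume k: "k \<in> \<beta>"
        have "\<bar>p k * (\<Theta> k \<bullet> \<delta>)\<bar> \<le> 1 * norm \<delta>"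
          unfolding abs_mult using p_pos[OF k] p_le_1[OF k] coef_le_norm[OF beta_less[OF k]]
          by (intro mult_mono) auto
        moreover have "\<epsilon>2 * (1 + norm \<delta>) \<le> \<epsilon>2 * 2"
          using \<delta>_small \<eta>(2) \<epsilon>2(1) by (intro mult_left_mono) auto
        ultimately have "\<bar>g k - \<Theta> k \<bullet> S\<bar> \<le> \<eta> + 2 * \<epsilon>2" using err[OF k] \<delta>_small by linarith
        also have "\<dots> \<le> \<eta>1 / (4 * (b + 1)) + 2 * (\<eta>1 / (8 * (b + 1)))" using \<eta>(3) \<epsilon>2(3) by linarith
        also have "\<dots> = \<eta>1 / (2 * (b + 1))"
        proof -
          have "\<eta>1 / (4 * q) + 2 * (\<eta>1 / (8 * q)) = \<eta>1 / (2 * q)" if "q > 0" for q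
            using that by (simp add: field_simps)
          then show ?thesis by this (use bc in simp)
        qed
        finally show "norm ((g k - \<Theta> k \<bullet> S) *\<^sub>R \<Theta> k) \<le> \<eta>1 / (2 * (b + 1))"
          by (simp add: norm_Theta beta_less k)
      qed
      also have "\<dots> = b * (\<eta>1 / (2 * (b + 1)))" by (simp add: b_def)
      also have "\<dots> < \<eta>1" using bc \<eta>1(1) by (simp add: field_simps add_nonneg_pos)
      finally show ?thesis .
    qed
    have "X - Xbar = \<rho> *\<^sub>R (Dhat + \<delta>)" using \<rho>(1) by (simp add: \<delta>_def)
    then have "norm (X - Xbar) = \<rho> * norm (Dhat + \<delta>)" using \<rho>(1) by simp
    also have "\<dots> \<le> \<epsilon> * (c + 1)"
      using \<rho> norm_triangle_ineq[of Dhat \<delta>] \<delta>_small \<eta>(2) by (intro mult_mono) (auto simp: c_def)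
    finally have near: "norm (X - Xbar) \<le> \<epsilon>2" using \<epsilon>c(2) by linarith
    have "rank X \<le> r"
    proof (rule \<eta>1(2)[OF X_Sym _ e_Sym \<open>norm e < \<eta>1\<close>])
      show "norm (X - Xbar) < \<eta>1" using near \<epsilon>2(4) by linarith
      show "(S + e) \<bullet> (X ** W + adjm W ** X) = 0"
        if "entries_in_K rc W" "\<forall>k\<in>\<alpha>. \<Theta> k \<bullet> (X ** W + adjm W ** X) = 0" for W
        by (rule tangent_annihilation[OF X VI that])
    qed
    moreover have "r \<le> rank X" using near \<epsilon>2(5) by (intro \<eta>2(2)) linarith
    ultimately show "rank X = r" by simp
  qed
qed

end

section \<open>Probabilistic estimates\<close>

context prob_space
begin

text \<open>Chebyshev: the mixed moments vanish, so the sum has second moment at most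
  \<open>m C\<close>.\<close>

lemma prob_mean_tail:
  fixes V :: "nat \<Rightarrow> 'a \<Rightarrow> real"
  assumes V: "\<And>i. V i \<in> borel_measurable M"
    and sq: "\<And>i. integrable M (\<lambda>x. (V i x)\<^sup>2)" "\<And>i. expectation (\<lambda>x. (V i x)\<^sup>2) \<le> C"
    and uncor: "\<And>i j. i \<noteq> j \<Longrightarrow> expectation (\<lambda>x. V i x * V j x) = 0"
    and m: "m > 0" and t: "t > 0"
  shows "prob {x \<in> space M. t < \<bar>(\<Sum>i<m. V i x) / real m\<bar>} \<le> C / (real m * t\<^sup>2)"
proof -
  note [measurable] = V
  have prod: "integrable M (\<lambda>x. V i x * V j x)" for i j
  proof (rule Bochner_Integration.integrable_bound[OF Bochner_Integration.integrable_add[OF sq(1)[of i] sq(1)[of j]]])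
    show "AE x in M. norm (V i x * V j x) \<le> norm ((V i x)\<^sup>2 + (V j x)\<^sup>2)"
    proof (rule AE_I2)
      fix x
      have "2 * (\<bar>V i x\<bar> * \<bar>V j x\<bar>) \<le> (V i x)\<^sup>2 + (V j x)\<^sup>2"
        using zero_le_power2[of "\<bar>V i x\<bar> - \<bar>V j x\<bar>"] by (simp add: power2_diff)
      moreover have "0 \<le> \<bar>V i x\<bar> * \<bar>V j x\<bar>" by simp
      ultimately have "\<bar>V i x\<bar> * \<bar>V j x\<bar> \<le> (V i x)\<^sup>2 + (V j x)\<^sup>2" by linarith
      then show "norm (V i x * V j x) \<le> norm ((V i x)\<^sup>2 + (V j x)\<^sup>2)"
        by (simp add: abs_mult)
    qed
  qed simp
  define Z where "Z x = (\<Sum>i<m. V i x)" for x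
  have Z2: "(Z x)\<^sup>2 = (\<Sum>i<m. \<Sum>j<m. V i x * V j x)" for x
    by (simp add: Z_def power2_eq_square sum_product)
  have int: "integrable M (\<lambda>x. (Z x)\<^sup>2)"
    unfolding Z2 by (intro Bochner_Integration.integrable_sum prod)
  have "expectation (\<lambda>x. (Z x)\<^sup>2) = (\<Sum>i<m. \<Sum>j<m. expectation (\<lambda>x. V i x * V j x))"
    unfolding Z2 by (simp add: prod)
  also have "\<dots> = (\<Sum>i<m. \<Sum>j<m. if i = j then expectation (\<lambda>x. (V i x)\<^sup>2) else 0)"
    by (intro sum.cong refl) (auto simp: uncor power2_eq_square)
  also have "\<dots> = (\<Sum>i<m. expectation (\<lambda>x. (V i x)\<^sup>2))" by simp
  also have "\<dots> \<le> (\<Sum>i<m. C)" by (intro sum_mono sq(2))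
  finally have EZ: "expectation (\<lambda>x. (Z x)\<^sup>2) \<le> real m * C" by simp
  have "prob {x \<in> space M. t < \<bar>Z x / real m\<bar>} \<le> prob {x \<in> space M. (real m * t)\<^sup>2 \<le> (Z x)\<^sup>2}"
  proof (rule finite_measure_mono)
    show "{x \<in> space M. t < \<bar>Z x / real m\<bar>} \<subseteq> {x \<in> space M. (real m * t)\<^sup>2 \<le> (Z x)\<^sup>2}"
    proof safe
      fix x assume "t < \<bar>Z x / real m\<bar>"
      then have "real m * t \<le> \<bar>Z x\<bar>" using m by (simp add: abs_divide field_simps)
      then have "(real m * t)\<^sup>2 \<le> \<bar>Z x\<bar>\<^sup>2" using t by (intro power_mono) auto
      then show "(real m * t)\<^sup>2 \<le> (Z x)\<^sup>2" by simp
    qed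
  qed (simp add: Z_def)
  also have "\<dots> \<le> expectation (\<lambda>x. (Z x)\<^sup>2) / (real m * t)\<^sup>2"
    using m t by (intro integral_Markov_inequality_measure[where A = "{}"] int) auto
  also have "\<dots> \<le> real m * C / (real m * t)\<^sup>2" by (intro divide_right_mono EZ) simp
  also have "\<dots> = C / (real m * t\<^sup>2)" using m by (simp add: power2_eq_square)
  finally show ?thesis by (simp add: Z_def)
qed

lemma tendsto_prob_Un:
  assumes "(\<lambda>m. prob (A m)) \<longlonglongrightarrow> 0" "(\<lambda>m. prob (B m)) \<longlonglongrightarrow> 0"
    and "\<And>m. A m \<in> events" "\<And>m. B m \<in> events"
  shows "(\<lambda>m. prob (A m \<union> B m)) \<longlonglongrightarrow> 0"
proof (rule tendsto_sandwich[OF _ _ tendsto_const])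
  show "(\<lambda>m. prob (A m) + prob (B m)) \<longlonglongrightarrow> 0" using tendsto_add[OF assms(1,2)] by simp
qed (use assms in \<open>auto intro!: always_eventually measure_Un_le\<close>)

lemma tendsto_prob_UN:
  assumes "finite K" "\<And>k. k \<in> K \<Longrightarrow> (\<lambda>m. prob (A k m)) \<longlonglongrightarrow> 0" "\<And>k m. k \<in> K \<Longrightarrow> A k m \<in> events"
  shows "(\<lambda>m. prob (\<Union>k\<in>K. A k m)) \<longlonglongrightarrow> 0"
  using assms
proof (induction K)
  case (insert k K)
  then show ?case by (simp only: UN_insert) (intro tendsto_prob_Un, auto)
qed simp

lemma tendsto_prob_leI:
  assumes "\<And>\<delta>. \<delta> > 0 \<Longrightarrow> eventually (\<lambda>m. prob (A m) < \<delta>) sequentially"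
  shows "(\<lambda>m. prob (A m)) \<longlonglongrightarrow> 0"
proof (rule order_tendstoI)
  fix a :: real assume "a < 0"
  then show "\<forall>\<^sub>F m in sequentially. a < prob (A m)"
    by (intro always_eventually allI less_le_trans[OF _ measure_nonneg])
qed (use assms in auto)

text \<open>The expectation factors, and one factor is centred. The sum type indexes labels and
  noise jointly, so this serves both the frequencies and the mixed moments of noise with
  labels.\<close>

lemma indep_product_expectation_zero:
  fixes \<omega> :: "nat \<Rightarrow> 'a \<Rightarrow> nat" and \<xi> :: "nat \<Rightarrow> 'a \<Rightarrow> real" and g :: "real \<Rightarrow> real"
  assumes ind: "indep_vars (\<lambda>_. borel) (\<lambda>j. case j of Inl i \<Rightarrow> (\<lambda>x. real (\<omega> i x)) | Inr i \<Rightarrow> \<xi> i) (UNIV :: (nat + nat) set)"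
    and g: "g \<in> borel_measurable borel"
  defines "Z \<equiv> \<lambda>j. case j of Inl i \<Rightarrow> (\<lambda>x. g (real (\<omega> i x))) | Inr i \<Rightarrow> \<xi> i"
  assumes J: "finite J" and int: "\<And>j. j \<in> J \<Longrightarrow> integrable M (Z j)"
    and j: "j \<in> J" "expectation (Z j) = 0"
  shows "expectation (\<lambda>x. \<Prod>j\<in>J. Z j x) = 0"
proof -
  have "indep_vars (\<lambda>_. borel) (\<lambda>j x. (case j of Inl i \<Rightarrow> g | Inr i \<Rightarrow> (\<lambda>x. x))
      ((case j of Inl i \<Rightarrow> (\<lambda>x. real (\<omega> i x)) | Inr i \<Rightarrow> \<xi> i) x)) (UNIV :: (nat + nat) set)"
    by (rule indep_vars_compose2[OF ind]) (auto split: sum.split intro: g)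
  also have "(\<lambda>j x. (case j of Inl i \<Rightarrow> g | Inr i \<Rightarrow> (\<lambda>x. x))
      ((case j of Inl i \<Rightarrow> (\<lambda>x. real (\<omega> i x)) | Inr i \<Rightarrow> \<xi> i) x)) = Z"
    by (auto simp: Z_def fun_eq_iff split: sum.split)
  finally have "indep_vars (\<lambda>_. borel) Z J" by (rule indep_vars_subset) simp
  then have "expectation (\<lambda>x. \<Prod>j\<in>J. Z j x) = (\<Prod>j\<in>J. expectation (Z j))"
    by (intro indep_vars_lebesgue_integral J int) auto
  then show ?thesis using J j prod_zero by auto
qed

text \<open>Chebyshev gives the bound \<open>\<nu>^2 / (\<epsilon>^2 m \<rho>^2)\<close>, which
  vanishes since \<open>sqrt m * \<rho>\<close> diverges.\<close>

lemma tendsto_prob_noise: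
  fixes \<omega> :: "nat \<Rightarrow> 'a \<Rightarrow> nat" and \<xi> :: "nat \<Rightarrow> 'a \<Rightarrow> real"
  assumes ind: "indep_vars (\<lambda>_. borel) (\<lambda>j. case j of Inl i \<Rightarrow> (\<lambda>x. real (\<omega> i x)) | Inr i \<Rightarrow> \<xi> i) (UNIV :: (nat + nat) set)"
    and \<omega>_meas: "\<And>i. \<omega> i \<in> M \<rightarrow>\<^sub>M count_space UNIV"
    and \<xi>_int: "\<And>i. integrable M (\<xi> i)" "\<And>i. expectation (\<xi> i) = 0"
    and \<xi>_sq: "\<And>i. integrable M (\<lambda>x. (\<xi> i x)\<^sup>2)" "\<And>i. expectation (\<lambda>x. (\<xi> i x)\<^sup>2) = 1"
    and \<rho>: "\<And>m. 0 < \<rho> m" "filterlim (\<lambda>m. sqrt (real m) * \<rho> m) at_top sequentially" and \<epsilon>: "\<epsilon> > 0"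
  shows "(\<lambda>m. prob {x \<in> space M. \<epsilon> * \<rho> m < \<bar>noise (\<lambda>i. \<omega> i x) (\<lambda>i. \<nu> * \<xi> i x) m k\<bar>}) \<longlonglongrightarrow> 0"
proof -
  note [measurable] = \<omega>_meas borel_measurable_integrable[OF \<xi>_int(1)]
  define V where "V i x = \<nu> * \<xi> i x * of_bool (\<omega> i x = k)" for i x
  define g :: "real \<Rightarrow> real" where "g r = of_bool (r = real k)" for r
  have g: "g \<in> borel_measurable borel" unfolding g_def by measurable
  have V_meas [measurable]: "V i \<in> borel_measurable M" for i unfolding V_def by measurable
  have Vsq: "(V i x)\<^sup>2 \<le> \<nu>\<^sup>2 * (\<xi> i x)\<^sup>2" for i x
    by (cases "\<omega> i x = k") (simp_all add: V_def power_mult_distrib)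
  have int: "integrable M (\<lambda>x. (V i x)\<^sup>2)" for i
    by (rule Bochner_Integration.integrable_bound[OF integrable_mult_right[OF \<xi>_sq(1), of "\<nu>\<^sup>2" i]])
      (use Vsq in auto)
  have bound: "expectation (\<lambda>x. (V i x)\<^sup>2) \<le> \<nu>\<^sup>2" for i
  proof -
    have "expectation (\<lambda>x. (V i x)\<^sup>2) \<le> expectation (\<lambda>x. \<nu>\<^sup>2 * (\<xi> i x)\<^sup>2)"
      by (intro integral_mono int integrable_mult_right \<xi>_sq Vsq)
    then show ?thesis by (simp add: \<xi>_sq)
  qed
  have uncor: "expectation (\<lambda>x. V i x * V j x) = 0" if "i \<noteq> j" for i j
  proof -
    let ?Z = "\<lambda>j. case j of Inl i \<Rightarrow> (\<lambda>x. g (real (\<omega> i x))) | Inr i \<Rightarrow> \<xi> i"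
    \<comment> \<open>\<open>V i * V j\<close> consists of two label indicators and two noise
      factors at four distinct indices; the centred \<open>\<xi> i\<close> annihilates the
      mean.\<close>
    let ?J = "{Inl i, Inl j, Inr i, Inr j}"
    have "integrable M (\<lambda>x. g (real (\<omega> l x)))" for l
      by (rule integrable_const_bound[where B = 1]) (auto simp: g_def)
    then have "expectation (\<lambda>x. \<Prod>l\<in>?J. ?Z l x) = 0"
      by (intro indep_product_expectation_zero[OF ind g, where j = "Inr i"]) (auto simp: \<xi>_int)
    moreover have "(\<Prod>l\<in>?J. ?Z l x) = g (real (\<omega> i x)) * g (real (\<omega> j x)) * \<xi> i x * \<xi> j x" for x
      using that by simp
    ultimately have "expectation (\<lambda>x. g (real (\<omega> i x)) * g (real (\<omega> j x)) * \<xi> i x * \<xi> j x) = 0" by simp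
    moreover have "V i x * V j x = \<nu>\<^sup>2 * (g (real (\<omega> i x)) * g (real (\<omega> j x)) * \<xi> i x * \<xi> j x)" for x
      by (simp add: V_def g_def power2_eq_square)
    ultimately show ?thesis by simp
  qed
  have le: "prob {x \<in> space M. \<epsilon> * \<rho> m < \<bar>noise (\<lambda>i. \<omega> i x) (\<lambda>i. \<nu> * \<xi> i x) m k\<bar>}
      \<le> \<nu>\<^sup>2 / \<epsilon>\<^sup>2 * (inverse (sqrt (real m) * \<rho> m))\<^sup>2" if "m > 0" for m
  proof -
    have "prob {x \<in> space M. \<epsilon> * \<rho> m < \<bar>(\<Sum>i<m. V i x) / real m\<bar>} \<le> \<nu>\<^sup>2 / (real m * (\<epsilon> * \<rho> m)\<^sup>2)"
      by (rule prob_mean_tail[OF V_meas int bound uncor that]) (use \<epsilon> \<rho> in simp_all)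
    also have "\<dots> = \<nu>\<^sup>2 / \<epsilon>\<^sup>2 * (inverse (sqrt (real m) * \<rho> m))\<^sup>2"
      by (simp add: power_mult_distrib power_inverse divide_inverse)
    finally show ?thesis by (simp add: noise_def V_def)
  qed
  show ?thesis
  proof (rule tendsto_sandwich[OF _ _ tendsto_const])
    show "\<forall>\<^sub>F m in sequentially. prob {x \<in> space M. \<epsilon> * \<rho> m < \<bar>noise (\<lambda>i. \<omega> i x) (\<lambda>i. \<nu> * \<xi> i x) m k\<bar>}
        \<le> \<nu>\<^sup>2 / \<epsilon>\<^sup>2 * (inverse (sqrt (real m) * \<rho> m))\<^sup>2"
      using eventually_gt_at_top[of 0] by eventually_elim (rule le)
    have "(\<lambda>m. \<nu>\<^sup>2 / \<epsilon>\<^sup>2 * (inverse (sqrt (real m) * \<rho> m))\<^sup>2) \<longlonglongrightarrow> \<nu>\<^sup>2 / \<epsilon>\<^sup>2 * 0\<^sup>2"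
      by (intro tendsto_intros tendsto_inverse_0_at_top \<rho>(2))
    then show "(\<lambda>m. \<nu>\<^sup>2 / \<epsilon>\<^sup>2 * (inverse (sqrt (real m) * \<rho> m))\<^sup>2) \<longlonglongrightarrow> 0" by simp
  qed simp
qed

lemma tendsto_prob_freq:
  fixes \<omega> :: "nat \<Rightarrow> 'a \<Rightarrow> nat" and \<xi> :: "nat \<Rightarrow> 'a \<Rightarrow> real"
  assumes ind: "indep_vars (\<lambda>_. borel) (\<lambda>j. case j of Inl i \<Rightarrow> (\<lambda>x. real (\<omega> i x)) | Inr i \<Rightarrow> \<xi> i) (UNIV :: (nat + nat) set)"
    and \<omega>_meas: "\<And>i. \<omega> i \<in> M \<rightarrow>\<^sub>M count_space UNIV"
    and dist: "\<And>i. prob {x \<in> space M. \<omega> i x = k} = q" and \<epsilon>: "\<epsilon> > 0"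
  shows "(\<lambda>m. prob {x \<in> space M. \<epsilon> < \<bar>freq (\<lambda>i. \<omega> i x) m k - q\<bar>}) \<longlonglongrightarrow> 0"
proof -
  note [measurable] = \<omega>_meas
  have q: "0 \<le> q" "q \<le> 1" using dist[of 0] by auto
  define V where "V i x = of_bool (\<omega> i x = k) - q" for i x
  define g :: "real \<Rightarrow> real" where "g r = of_bool (r = real k) - q" for r
  have g: "g \<in> borel_measurable borel" unfolding g_def by measurable
  have V_g: "V i x = g (real (\<omega> i x))" for i x by (simp add: V_def g_def)
  have V_meas [measurable]: "V i \<in> borel_measurable M" for i unfolding V_def by measurable
  have Vabs: "\<bar>V i x\<bar> \<le> 1" for i x using q by (auto simp: V_def)
  then have Vsq: "(V i x)\<^sup>2 \<le> 1" for i x by (simp add: abs_square_le_1)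
  have int1: "integrable M (V i)" for i
    by (rule integrable_const_bound[where B = 1]) (use Vabs in auto)
  have int: "integrable M (\<lambda>x. (V i x)\<^sup>2)" for i
    by (rule integrable_const_bound[where B = 1]) (use Vsq in auto)
  have bound: "expectation (\<lambda>x. (V i x)\<^sup>2) \<le> 1" for i
    using integral_mono[OF int integrable_const[of 1] Vsq] by (simp add: prob_space)
  have E0: "expectation (V i) = 0" for i
  proof -
    have "expectation (V i) = expectation (\<lambda>x. indicator {x \<in> space M. \<omega> i x = k} x - q)"
      by (rule Bochner_Integration.integral_cong) (auto simp: V_def indicator_def)
    also have "\<dots> = prob {x \<in> space M. \<omega> i x = k} - q"
      by (subst Bochner_Integration.integral_diff) (auto simp: prob_space less_top[symmetric])
    finally show ?thesis by (simp add: dist)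
  qed
  have uncor: "expectation (\<lambda>x. V i x * V j x) = 0" if "i \<noteq> j" for i j
  proof -
    let ?Z = "\<lambda>j. case j of Inl i \<Rightarrow> (\<lambda>x. g (real (\<omega> i x))) | Inr i \<Rightarrow> \<xi> i"
    have "expectation (\<lambda>x. \<Prod>l\<in>{Inl i, Inl j}. ?Z l x) = 0"
      using int1 E0 by (intro indep_product_expectation_zero[OF ind g, where j = "Inl i"])
        (auto simp: V_g[abs_def])
    then show ?thesis using that by (simp add: V_g)
  qed
  have le: "prob {x \<in> space M. \<epsilon> < \<bar>freq (\<lambda>i. \<omega> i x) m k - q\<bar>} \<le> 1 / \<epsilon>\<^sup>2 * inverse (real m)"
    if "m > 0" for m
  proof -
    have "(\<Sum>i<m. V i x) / real m = freq (\<lambda>i. \<omega> i x) m k - q" for x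
      using that by (simp add: V_def freq_def sum_subtractf diff_divide_distrib)
    moreover have "prob {x \<in> space M. \<epsilon> < \<bar>(\<Sum>i<m. V i x) / real m\<bar>} \<le> 1 / (real m * \<epsilon>\<^sup>2)"
      by (rule prob_mean_tail[OF V_meas int bound uncor that \<epsilon>])
    ultimately show ?thesis by (simp add: divide_inverse mult.commute)
  qed
  show ?thesis
  proof (rule tendsto_sandwich[OF _ _ tendsto_const])
    show "\<forall>\<^sub>F m in sequentially. prob {x \<in> space M. \<epsilon> < \<bar>freq (\<lambda>i. \<omega> i x) m k - q\<bar>} \<le> 1 / \<epsilon>\<^sup>2 * inverse (real m)"
      using eventually_gt_at_top[of 0] by eventually_elim (rule le)
    show "(\<lambda>m. 1 / \<epsilon>\<^sup>2 * inverse (real m)) \<longlonglongrightarrow> 0"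
      using tendsto_mult[OF tendsto_const lim_inverse_n, of "1 / \<epsilon>\<^sup>2"] by simp
  qed simp
qed

text \<open>Outside the two events that \<open>\<gamma>\<close> exceeds its tightness bound or
  \<open>U\<close> exceeds \<open>\<epsilon> / D\<close>, the product is at most \<epsilon>.\<close>

lemma tendsto_prob_tight_mult:
  fixes \<gamma> U :: "nat \<Rightarrow> 'a \<Rightarrow> real"
  assumes \<gamma>: "\<And>m. \<gamma> m \<in> borel_measurable M" "\<And>m x. x \<in> space M \<Longrightarrow> 0 \<le> \<gamma> m x"
    and U: "\<And>m. U m \<in> borel_measurable M" "\<And>m x. 0 \<le> U m x"
    and tight: "\<And>e. e > 0 \<Longrightarrow> \<exists>C N. \<forall>m\<ge>N. prob {x \<in> space M. C < \<bar>\<gamma> m x\<bar>} < e"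
    and conv: "\<And>e. e > 0 \<Longrightarrow> (\<lambda>m. prob {x \<in> space M. e < U m x}) \<longlonglongrightarrow> 0" and \<epsilon>: "\<epsilon> > 0"
  shows "(\<lambda>m. prob {x \<in> space M. \<epsilon> < \<gamma> m x * U m x}) \<longlonglongrightarrow> 0"
proof (rule tendsto_prob_leI)
  note [measurable] = \<gamma>(1) U(1)
  fix \<delta> :: real assume \<delta>: "\<delta> > 0"
  obtain C N where CN: "\<And>m. m \<ge> N \<Longrightarrow> prob {x \<in> space M. C < \<bar>\<gamma> m x\<bar>} < \<delta> / 2"
    using tight[of "\<delta> / 2"] \<delta> by auto
  \<comment> \<open>Tightness may supply a nonpositive \<open>C\<close>; the maximum makes
    \<open>\<epsilon> / D\<close> a positive threshold.\<close>
  define D where "D = max C 1"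
  have D: "D > 0" "C \<le> D" by (auto simp: D_def)
  have "eventually (\<lambda>m. prob {x \<in> space M. \<epsilon> / D < U m x} < \<delta> / 2) sequentially"
    using conv[of "\<epsilon> / D"] \<epsilon> D \<delta> by (intro order_tendstoD(2)[where y = 0]) auto
  then show "eventually (\<lambda>m. prob {x \<in> space M. \<epsilon> < \<gamma> m x * U m x} < \<delta>) sequentially"
    using eventually_ge_at_top[of N]
  proof eventually_elim
    case (elim m)
    have "prob {x \<in> space M. \<epsilon> < \<gamma> m x * U m x}
        \<le> prob ({x \<in> space M. C < \<bar>\<gamma> m x\<bar>} \<union> {x \<in> space M. \<epsilon> / D < U m x})"
    proof (rule finite_measure_mono)
      show "{x \<in> space M. \<epsilon> < \<gamma> m x * U m x} \<subseteq> {x \<in> space M. C < \<bar>\<gamma> m x\<bar>} \<union> {x \<in> space M. \<epsilon> / D < U m x}"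
      proof (safe, rule ccontr)
        fix x assume x: "x \<in> space M" "\<epsilon> < \<gamma> m x * U m x" "\<not> \<epsilon> / D < U m x" "\<not> C < \<bar>\<gamma> m x\<bar>"
        have "\<gamma> m x * U m x \<le> D * (\<epsilon> / D)" using x \<gamma>(2) U(2) D by (intro mult_mono) auto
        then show False using x(2) D by simp
      qed
    qed measurable
    also have "\<dots> \<le> prob {x \<in> space M. C < \<bar>\<gamma> m x\<bar>} + prob {x \<in> space M. \<epsilon> / D < U m x}"
      by (rule measure_Un_le) measurable
    also have "\<dots> < \<delta>" using CN[of m] elim by linarith
    finally show ?case .
  qed
qed

end

theorem mainTheorem15:
  fixes rc :: bool
    and \<Theta> :: "nat \<Rightarrow> ((complex, 'n::{finite,linorder}) vec, 'n) vec"
    and d :: nat and \<alpha> \<beta> :: "nat set" and p :: "nat \<Rightarrow> real"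
    and Xbar Pbar :: "((complex, 'n) vec, 'n) vec" and lam :: "(real, 'n) vec" and r :: nat
    and M :: "'a measure"
    and \<omega> :: "nat \<Rightarrow> 'a \<Rightarrow> nat" and \<xi> :: "nat \<Rightarrow> 'a \<Rightarrow> real" and \<nu> :: real
    and f :: "(real, 'n) vec \<Rightarrow> (real, 'n) vec" and F :: "((complex, 'n) vec, 'n) vec \<Rightarrow> ((complex, 'n) vec, 'n) vec"
    and Xt Xh :: "nat \<Rightarrow> 'a \<Rightarrow> ((complex, 'n) vec, 'n) vec"
    and \<rho> :: "nat \<Rightarrow> real" and \<gamma> :: "nat \<Rightarrow> 'a \<Rightarrow> real"
  assumes basis_in: "\<forall>k<d. \<Theta> k \<in> SymK rc"
    and basis_orth: "\<forall>j<d. \<forall>k<d. ipS (\<Theta> j) (\<Theta> k) = (if j = k then 1 else 0)"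
    and basis_span: "SymK rc \<subseteq> span (\<Theta> ` {..<d})"
    and alpha: "\<alpha> \<subseteq> {..<d}" and beta: "\<beta> = {..<d} - \<alpha>"
    and p_pos: "\<forall>k\<in>\<beta>. 0 < p k" and p_sum: "(\<Sum>k\<in>\<beta>. p k) = 1"
    and Xbar_psd: "psdK rc Xbar" and rank_Xbar: "rank Xbar = r" and r_pos: "1 \<le> r"
    and Pbar: "unitaryK rc Pbar" and lam: "nonincr lam"
    and eig: "Xbar = Pbar ** diagm lam ** adjm Pbar"
    and M: "prob_space M"
    and \<omega>_meas: "\<forall>i. \<omega> i \<in> measurable M (count_space UNIV)"
    and \<xi>_meas: "\<forall>i. \<xi> i \<in> borel_measurable M"
    and \<omega>_dist: "\<forall>i k. measure M {x \<in> space M. \<omega> i x = k} = (if k \<in> \<beta> then p k else 0)"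
    and \<xi>_ident: "\<forall>i. distr M borel (\<xi> i) = distr M borel (\<xi> 0)"
    and indep: "prob_space.indep_vars M (\<lambda>_. borel)
                  (\<lambda>j. case j of Inl i \<Rightarrow> (\<lambda>x. real (\<omega> i x)) | Inr i \<Rightarrow> \<xi> i) (UNIV :: (nat + nat) set)"
    and \<xi>_mean: "\<forall>i. integrable M (\<xi> i) \<and> (\<integral>x. \<xi> i x \<partial>M) = 0"
    and \<xi>_var: "\<forall>i. integrable M (\<lambda>x. (\<xi> i x)\<^sup>2) \<and> (\<integral>x. (\<xi> i x)\<^sup>2 \<partial>M) = 1"
    and \<nu>: "0 < \<nu>"
    and F: "spectral_op rc f F"
    and F_cont: "continuous (at Xbar within SymK rc) F"
    and Xt_meas: "\<forall>m. Xt m \<in> borel_measurable M"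
    and Xt_psd: "\<forall>m. \<forall>x\<in>space M. psdK rc (Xt m x)"
    and Xt_conv: "\<forall>e>0. (\<lambda>m. measure M {x \<in> space M. e < norm (Xt m x - Xbar)}) \<longlonglongrightarrow> 0"
    and \<rho>_pos: "\<forall>m. 0 < \<rho> m"
    and \<gamma>_meas: "\<forall>m. \<gamma> m \<in> borel_measurable M"
    and \<gamma>_nonneg: "\<forall>m. \<forall>x\<in>space M. 0 \<le> \<gamma> m x"
    and Xh_meas: "\<forall>m. Xh m \<in> borel_measurable M"
    and Xh_opt: "\<forall>m>0. \<forall>x\<in>space M.
        Xh m x \<in> SymK rc \<and> psdK rc (Xh m x) \<and> (\<forall>k\<in>\<alpha>. ipS (\<Theta> k) (Xh m x) = ipS (\<Theta> k) Xbar) \<and>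
        (\<forall>X. X \<in> SymK rc \<and> psdK rc X \<and> (\<forall>k\<in>\<alpha>. ipS (\<Theta> k) X = ipS (\<Theta> k) Xbar) \<longrightarrow>
           objective \<Theta> (\<lambda>i. \<omega> i x) (\<lambda>i. ipS (\<Theta> (\<omega> i x)) Xbar + \<nu> * \<xi> i x) m (\<rho> m) (\<gamma> m x) F (Xt m x) (Xh m x)
           \<le> objective \<Theta> (\<lambda>i. \<omega> i x) (\<lambda>i. ipS (\<Theta> (\<omega> i x)) Xbar + \<nu> * \<xi> i x) m (\<rho> m) (\<gamma> m x) F (Xt m x) X)"
    and slater: "\<exists>X0. pdK rc X0 \<and> (\<forall>k\<in>\<alpha>. ipS (\<Theta> k) X0 = ipS (\<Theta> k) Xbar)"
    and \<rho>_lim: "\<rho> \<longlonglongrightarrow> 0"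
    and \<rho>_sqrt: "filterlim (\<lambda>m. sqrt (real m) * \<rho> m) at_top sequentially"
    and \<gamma>_Op1: "\<forall>e>0. \<exists>C N. \<forall>m\<ge>N. measure M {x \<in> space M. C < \<bar>\<gamma> m x\<bar>} < e"
    and sys: "\<exists>Lh. block_sym rc r Lh \<and> lin_system \<Theta> \<beta> p Pbar (F Xbar) r Lh
                 \<and> (\<forall>L. block_sym rc r L \<and> lin_system \<Theta> \<beta> p Pbar (F Xbar) r L \<longrightarrow> L = Lh)
                 \<and> block_pd rc r Lh"
  shows "(\<lambda>m. measure M {x \<in> space M. rank (Xh m x) = rank Xbar}) \<longlonglongrightarrow> 1"
proof -
  interpret prob_space M by (rule M)
  obtain X0 where X0: "pdK rc X0" "\<forall>k\<in>\<alpha>. ipS (\<Theta> k) X0 = ipS (\<Theta> k) Xbar" using slater by blast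
  obtain Lh where Lh: "block_sym rc r Lh" "lin_system \<Theta> \<beta> p Pbar (F Xbar) r Lh" "block_pd rc r Lh"
    "\<And>L. block_sym rc r L \<Longrightarrow> lin_system \<Theta> \<beta> p Pbar (F Xbar) r L \<Longrightarrow> L = Lh"
    using sys by blast
  interpret psd_completion rc \<Theta> d \<alpha> \<beta> p Xbar Pbar lam r "F Xbar" Lh X0
  proof
    show "\<Theta> k \<in> SymK rc" if "k < d" for k using basis_in that by blast
    show "\<Theta> j \<bullet> \<Theta> k = (if j = k then 1 else 0)" if "j < d" "k < d" for j k
      using basis_orth that unfolding ipS_eq_inner by blast
    show "0 < p k" if "k \<in> \<beta>" for k using p_pos that by blast
    show "\<Theta> k \<bullet> X0 = \<Theta> k \<bullet> Xbar" if "k \<in> \<alpha>" for k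
      using X0(2) that unfolding ipS_eq_inner by blast
  qed (fact basis_span alpha beta p_sum Xbar_psd rank_Xbar Pbar lam eig X0(1) Lh)+
  note [measurable] = \<omega>_meas[rule_format] \<xi>_meas[rule_format] Xt_meas[rule_format] \<gamma>_meas[rule_format] Xh_meas[rule_format]
  obtain \<epsilon> where \<epsilon>: "\<epsilon> > 0" and det: "\<forall>m om z \<rho> \<gamma> F' Xt X. m > 0 \<longrightarrow> (\<forall>i<m. om i \<in> \<beta>) \<longrightarrow> 0 < \<rho> \<longrightarrow>
      \<rho> \<le> \<epsilon> \<longrightarrow> 0 \<le> \<gamma> \<longrightarrow> (\<forall>k\<in>\<beta>. \<bar>noise om z m k\<bar> \<le> \<epsilon> * \<rho> \<and> \<bar>freq om m k - p k\<bar> \<le> \<epsilon>) \<longrightarrow>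
      norm (F' Xt - F Xbar) \<le> \<epsilon> \<longrightarrow> \<gamma> * \<rho> \<le> \<epsilon> \<longrightarrow> \<gamma> * norm (Xt - Xbar) \<le> \<epsilon> \<longrightarrow> feasible X \<longrightarrow>
      (\<forall>Y. feasible Y \<longrightarrow> objective \<Theta> om (\<lambda>i. ipS (\<Theta> (om i)) Xbar + z i) m \<rho> \<gamma> F' Xt X
        \<le> objective \<Theta> om (\<lambda>i. ipS (\<Theta> (om i)) Xbar + z i) m \<rho> \<gamma> F' Xt Y) \<longrightarrow> rank X = r"
    using rank_eq_of_small_perturbation by (elim exE conjE)
  \<comment> \<open>\<open>F\<close> is continuous relative to \<open>SymK rc\<close>, in which
    \<open>Xt\<close> takes its values.\<close>
  obtain \<tau> where \<tau>: "\<tau> > 0" "\<And>X. X \<in> SymK rc \<Longrightarrow> norm (X - Xbar) < \<tau> \<Longrightarrow> norm (F X - F Xbar) < \<epsilon>"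
    using F_cont \<epsilon> unfolding continuous_within_eps_delta dist_norm by blast

  \<comment> \<open>A null set independent of \<open>m\<close>: each label avoids each value outside
    \<beta> almost surely, and there are countably many such pairs.\<close>
  define N where "N = {x \<in> space M. \<exists>i. \<omega> i x \<notin> \<beta>}"
  define B1 where "B1 k m = {x \<in> space M. \<epsilon> * \<rho> m < \<bar>noise (\<lambda>i. \<omega> i x) (\<lambda>i. \<nu> * \<xi> i x) m k\<bar>}" for k m
  define B2 where "B2 k m = {x \<in> space M. \<epsilon> < \<bar>freq (\<lambda>i. \<omega> i x) m k - p k\<bar>}" for k m
  \<comment> \<open>Half of \<tau>, because the complement gives a weak inequality and continuity
    asks for a strict one.\<close>
  define B3 where "B3 m = {x \<in> space M. \<tau> / 2 < norm (Xt m x - Xbar)}" for m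
  define B4 where "B4 m = {x \<in> space M. \<epsilon> < \<gamma> m x * \<rho> m}" for m
  define B5 where "B5 m = {x \<in> space M. \<epsilon> < \<gamma> m x * norm (Xt m x - Xbar)}" for m
  define U where "U m = ((\<Union>k\<in>\<beta>. B1 k m) \<union> (\<Union>k\<in>\<beta>. B2 k m)) \<union> (B3 m \<union> B4 m \<union> B5 m)" for m

  have ev: "B1 k m \<in> events" "B2 k m \<in> events" "B3 m \<in> events" "B4 m \<in> events" "B5 m \<in> events" for k m
    unfolding B1_def B2_def B3_def B4_def B5_def noise_def freq_def by measurable
  have N: "N \<in> events" "prob N = 0"
  proof -
    show "N \<in> events" unfolding N_def by measurable
    have "AE x in M. \<forall>i k. k \<notin> \<beta> \<longrightarrow> \<omega> i x \<noteq> k"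
      unfolding AE_all_countable
    proof (intro allI)
      fix i k
      show "AE x in M. k \<notin> \<beta> \<longrightarrow> \<omega> i x \<noteq> k"
      proof (cases "k \<in> \<beta>")
        case False
        then have "prob {x \<in> space M. \<omega> i x = k} = 0" using \<omega>_dist by simp
        then have "AE x in M. \<not> \<omega> i x = k"
          by (subst (asm) prob_Collect_eq_0) auto
        then show ?thesis by auto
      qed simp
    qed
    then have "AE x in M. \<not> (\<exists>i. \<omega> i x \<notin> \<beta>)" by eventually_elim auto
    then show "prob N = 0" unfolding N_def by (subst prob_Collect_eq_0) auto
  qed
  have "(\<lambda>m. prob (U m)) \<longlonglongrightarrow> 0"
    unfolding U_def
  proof (intro tendsto_prob_Un tendsto_prob_UN sets.Un sets.finite_UN ev finite_beta)
    fix k assume k: "k \<in> \<beta>"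
    show "(\<lambda>m. prob (B1 k m)) \<longlonglongrightarrow> 0"
      unfolding B1_def using \<xi>_mean \<xi>_var \<rho>_pos \<epsilon> \<omega>_meas
      by (intro tendsto_prob_noise[OF indep] \<rho>_sqrt) auto
    show "(\<lambda>m. prob (B2 k m)) \<longlonglongrightarrow> 0"
      unfolding B2_def using \<omega>_dist k \<epsilon> \<omega>_meas by (intro tendsto_prob_freq[OF indep]) auto
  next
    show "(\<lambda>m. prob (B3 m)) \<longlonglongrightarrow> 0"
      unfolding B3_def by (rule Xt_conv[rule_format]) (simp add: \<tau>(1))
    show "(\<lambda>m. prob (B4 m)) \<longlonglongrightarrow> 0"
      unfolding B4_def
    proof (rule tendsto_prob_tight_mult[OF _ _ _ _ _ _ \<epsilon>])
      fix e :: real assume "e > 0"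
      then have "\<forall>\<^sub>F m in sequentially. \<rho> m < e" using \<rho>_lim by (rule order_tendstoD(2)[rotated])
      then have "\<forall>\<^sub>F m in sequentially. prob {x \<in> space M. e < \<rho> m} = 0"
        by eventually_elim simp
      then show "(\<lambda>m. prob {x \<in> space M. e < \<rho> m}) \<longlonglongrightarrow> 0" by (rule tendsto_eventually)
    qed (use \<gamma>_meas \<gamma>_nonneg \<gamma>_Op1 \<rho>_pos in \<open>auto intro: less_imp_le\<close>)
    show "(\<lambda>m. prob (B5 m)) \<longlonglongrightarrow> 0"
      unfolding B5_def
      by (rule tendsto_prob_tight_mult[OF _ _ _ _ _ _ \<epsilon>])
        (use \<gamma>_meas \<gamma>_nonneg \<gamma>_Op1 Xt_conv in auto)
  qed
  then have lim: "(\<lambda>m. 1 - prob (N \<union> U m)) \<longlonglongrightarrow> 1"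
    using N tendsto_diff[OF tendsto_const tendsto_prob_Un[of "\<lambda>_. N" U], of 1]
    by (simp add: U_def sets.Un sets.finite_UN ev)

  have good: "rank (Xh m x) = rank Xbar"
    if m: "m > 0" "\<rho> m \<le> \<epsilon>" and x: "x \<in> space M" "x \<notin> N" "x \<notin> U m" for m x
  proof -
    have Xt_Sym: "Xt m x \<in> SymK rc" using Xt_psd x by (simp add: psdK_iff)
    have Xt_near: "norm (Xt m x - Xbar) < \<tau>"
      using x \<tau>(1) by (auto simp: U_def B3_def not_less)
    have feas: "feasible X \<longleftrightarrow> X \<in> SymK rc \<and> psdK rc X \<and> (\<forall>k\<in>\<alpha>. ipS (\<Theta> k) X = ipS (\<Theta> k) Xbar)" for X
      by (auto simp: feasible_def psdK_iff ipS_eq_inner)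
    have "rank (Xh m x) = r"
    proof (rule det[THEN spec[of _ m], THEN spec[of _ "\<lambda>i. \<omega> i x"], THEN spec[of _ "\<lambda>i. \<nu> * \<xi> i x"],
          THEN spec[of _ "\<rho> m"], THEN spec[of _ "\<gamma> m x"], THEN spec[of _ F], THEN spec[of _ "Xt m x"],
          THEN spec[of _ "Xh m x"], THEN mp, THEN mp, THEN mp, THEN mp, THEN mp, THEN mp, THEN mp,
          THEN mp, THEN mp, THEN mp, THEN mp])
      show "m > 0" "\<rho> m \<le> \<epsilon>" by (fact m)+
      show "\<forall>i<m. \<omega> i x \<in> \<beta>" using x by (auto simp: N_def)
      show "0 < \<rho> m" "0 \<le> \<gamma> m x" using \<rho>_pos \<gamma>_nonneg x by auto
      show "\<forall>k\<in>\<beta>. \<bar>noise (\<lambda>i. \<omega> i x) (\<lambda>i. \<nu> * \<xi> i x) m k\<bar> \<le> \<epsilon> * \<rho> m \<and> \<bar>freq (\<lambda>i. \<omega> i x) m k - p k\<bar> \<le> \<epsilon>"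
        using x by (auto simp: U_def B1_def B2_def not_less)
      show "norm (F (Xt m x) - F Xbar) \<le> \<epsilon>" using \<tau>(2)[OF Xt_Sym Xt_near] by simp
      show "\<gamma> m x * \<rho> m \<le> \<epsilon>" "\<gamma> m x * norm (Xt m x - Xbar) \<le> \<epsilon>"
        using x by (auto simp: U_def B4_def B5_def not_less)
      show "feasible (Xh m x)" using Xh_opt m x by (simp add: feas)
      show "\<forall>Y. feasible Y \<longrightarrow>
          objective \<Theta> (\<lambda>i. \<omega> i x) (\<lambda>i. ipS (\<Theta> (\<omega> i x)) Xbar + \<nu> * \<xi> i x) m (\<rho> m) (\<gamma> m x) F (Xt m x) (Xh m x)
          \<le> objective \<Theta> (\<lambda>i. \<omega> i x) (\<lambda>i. ipS (\<Theta> (\<omega> i x)) Xbar + \<nu> * \<xi> i x) m (\<rho> m) (\<gamma> m x) F (Xt m x) Y"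
        unfolding feas using Xh_opt m(1) x(1) by blast
    qed
    then show ?thesis by (simp add: rank_Xbar)
  qed
  show ?thesis
  proof (rule tendsto_sandwich[OF _ _ lim tendsto_const])
    have "\<forall>\<^sub>F m in sequentially. \<rho> m < \<epsilon>" using \<rho>_lim \<epsilon> by (rule order_tendstoD(2))
    then show "\<forall>\<^sub>F m in sequentially. 1 - prob (N \<union> U m) \<le> prob {x \<in> space M. rank (Xh m x) = rank Xbar}"
      using eventually_gt_at_top[of 0]
    proof eventually_elim
      case (elim m)
      have "N \<union> U m \<in> events" using N by (simp add: U_def sets.Un sets.finite_UN ev)
      then have "1 - prob (N \<union> U m) = prob (space M - (N \<union> U m))" by (simp add: prob_compl)
      also have "\<dots> \<le> prob {x \<in> space M. rank (Xh m x) = rank Xbar}"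
        by (rule finite_measure_mono) (use elim good in auto)
      finally show ?case .
    qed
  qed simp
qed

end
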